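(* Let $N\ge1$ be an integer, $\beta$ a positive integer and $\omega>0$ a real number. The generalized Hermite polynomials in superspace $J_\Lambda^\omega=e^{-\frac{1}{4\omega}\Delta}J_\Lambda$, where $\Lambda$ runs over all superpartitions with $N$ entries, form the unique basis of $P^{S_N}$ (indexed by superpartitions) such that $$\mathcal H_1^\omega J_\Lambda^\omega=|\Lambda|\,J_\Lambda^\omega\qquad\text{and}\qquad J_\Lambda^\omega=J_\Lambda+\sum_{\Omega<_u\Lambda}w_{\Lambda\Omega}(\beta,\omega,N)\,J_\Omega$$ for some coefficients $w_{\Lambda\Omega}(\beta,\omega,N)$.
   Context: **Superpolynomials.** A superpolynomial is an element of the algebra generated by commuting variables $x_1,\ldots,x_N$ and anticommuting variables $\theta_1,\ldots,\theta_N$ ($\theta_i\theta_j=-\theta_j\theta_i$, $\theta_i^2=0$), with complex coefficients. $x_{ij}=x_i-x_j$, $\partial_i=\partial/\partial x_i$. $K_{ij}$ exchanges $x_i,x_j$; $\kappa_{ij}$ exchanges $\theta_i,\theta_j$; $\mathcal K_{ij}=\kappa_{ij}K_{ij}$; for $w\in S_N$, $\mathcal K_w$ is the corresponding product of $\mathcal K_{i,i+1}$'s (simultaneous permutation of the $x$'s and $\theta$'s). $P^{S_N}$ is the space of symmetric superpolynomials: those $f$ with $\mathcal K_{ij}f=f$ for all $i,j$. **Superpartitions.** A superpartition (with $N$ entries, fermion number $m$, $0\le m\le N$) is $\Lambda=(\Lambda_1,\ldots,\Lambda_m;\Lambda_{m+1},\ldots,\Lambda_N)$ with nonnegative integers,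 $\Lambda_1>\cdots>\Lambda_m\ge0$ and $\Lambda_{m+1}\ge\cdots\ge\Lambda_N\ge0$. Its degree is $|\Lambda|=\sum_i\Lambda_i$; $\Lambda^*$ is the partition obtained by rearranging all entries in nonincreasing order. Dominance ordering on superpartitions of the same degree and fermion number: $\Omega\le\Lambda$ if either $\Omega^*<\Lambda^*$ in the usual dominance order on partitions, or $\Omega^*=\Lambda^*$ and $\Omega_1+\cdots+\Omega_k\le\Lambda_1+\cdots+\Lambda_k$ for all $k$. The $u$-ordering: $\Omega\le_u\Lambda$ if either $\Omega=\Lambda$ or $|\Omega|=|\Lambda|-2n$ for some $n\in\{1,2,3,\ldots\}$. **Monomials.** $m_\Lambda=\frac{1}{f_\Lambda}\sum_{\sigma\in S_N}\mathcal K_\sigma(\theta_1\cdots\theta_m x_1^{\Lambda_1}\cdots x_N^{\Lambda_N})$, with $f_\Lambda=\prod_{i\ge0}n(i)!$, $n(i)$ being the number of entries equal to $i$ in $(\Lambda_{m+1},\ldots,\Lambda_N)$. **Jack superpolynomials.** For superpolynomials $A=\sum_I\theta_IA_I(x)$, $B=\sum_I\theta_IB_I(x)$ (with $I=\{i_1<\cdots<i_m\}$, $\theta_I=\theta_{i_1}\cdots\theta_{i_m}$), put $$\langle A,B\rangle_\beta=\sum_I\prod_{j}\left(\frac1{2\pi i}\oint\frac{dx_j}{x_j}\right)\prod_{k\ne l}\left(1-\frac{x_k}{x_l}\right)^{\beta}\overline{A_I(x)}\,B_I(x),$$ the integrals being over the unit circle (so $\overline{x_j}=1/x_j$). The Jack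 superpolynomials $J_\Lambda=J_\Lambda(x,\theta;1/\beta)$ are the unique functions in $P^{S_N}$ such that $\langle J_\Lambda,J_\Omega\rangle_\beta=0$ for $\Lambda\ne\Omega$ and $J_\Lambda=m_\Lambda+\sum_{\Omega<\Lambda}t_{\Lambda,\Omega}(\beta)m_\Omega$. (Their existence and uniqueness are known; they form a basis of $P^{S_N}$.) **Operators.** With the rational Dunkl operators $D_j=\partial_j+\beta\sum_{k\ne j}\frac1{x_{jk}}(1-K_{jk})$, set $\Delta=\sum_{j=1}^ND_j^2$ (it lowers the degree in $x$ by $2$ and preserves $P^{S_N}$, so $e^{\pm\frac1{4\omega}\Delta}$ acts on each superpolynomial as a finite sum). The first rational conserved operator is $$\mathcal H_1^\omega=e^{-\frac1{4\omega}\Delta}\Big(\sum_{j=1}^Nx_j\partial_j\Big)e^{\frac1{4\omega}\Delta}$$ acting on $P^{S_N}$. *)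

theory Defs
  imports
    "HOL-Complex_Analysis.Complex_Analysis"
    "HOL-Combinatorics.Permutations"
    "HOL-Library.Poly_Mapping"
begin

section \<open>Polynomials in commuting variables\<close>

text \<open>Exponent vectors are finitely supported functions \<open>nat \<Rightarrow>\<^sub>0 nat\<close>. The variables
  \<open>x\<^sub>1, x\<^sub>2, \<dots>\<close> all live in one type; \<open>superpolynomials N\<close> below restricts to the first \<open>N\<close>.\<close>

type_synonym mpoly = "(nat \<Rightarrow>\<^sub>0 nat) \<Rightarrow>\<^sub>0 complex"

definition Const :: "complex \<Rightarrow> mpoly" where
  "Const c = Poly_Mapping.single 0 c"

definition Var :: "nat \<Rightarrow> mpoly" where
  "Var i = Poly_Mapping.single (Poly_Mapping.single i 1) 1"

definition eval_mpoly :: "mpoly \<Rightarrow> (nat \<Rightarrow> complex) \<Rightarrow> complex" where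
  "eval_mpoly p x = (\<Sum>e\<in>Poly_Mapping.keys p. Poly_Mapping.lookup p e *
     (\<Prod>i\<in>Poly_Mapping.keys e. x i ^ Poly_Mapping.lookup e i))"

definition partial_deriv :: "nat \<Rightarrow> mpoly \<Rightarrow> mpoly" where
  "partial_deriv i p = (\<Sum>e\<in>Poly_Mapping.keys p.
     Poly_Mapping.single (e - Poly_Mapping.single i 1)
       (of_nat (Poly_Mapping.lookup e i) * Poly_Mapping.lookup p e))"

text \<open>Substitution \<open>x\<^sub>i \<mapsto> x\<^bsub>w i\<^esub>\<close> for a bijection \<open>w\<close>: the exponent of \<open>x\<^sub>j\<close> in the image
  of \<open>x\<^sup>e\<close> is \<open>e (inv w j)\<close>.\<close>

definition perm_x :: "(nat \<Rightarrow> nat) \<Rightarrow> mpoly \<Rightarrow> mpoly" where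
  "perm_x w p = (\<Sum>e\<in>Poly_Mapping.keys p.
     Poly_Mapping.single (Poly_Mapping.map_key (inv w) e) (Poly_Mapping.lookup p e))"

text \<open>The operator \<open>(x\<^sub>j - x\<^sub>k)\<^sup>-\<^sup>1 (1 - K\<^sub>j\<^sub>k)\<close>.\<close>

definition divided_diff :: "nat \<Rightarrow> nat \<Rightarrow> mpoly \<Rightarrow> mpoly" where
  "divided_diff j k p = (THE q. (Var j - Var k) * q = p - perm_x (Transposition.transpose j k) p)"

lemma inj_inv_transpose: "inj (inv (Transposition.transpose j k))"
  by simp

lemma perm_x_sum_superset:
  assumes "finite S" "Poly_Mapping.keys p \<subseteq> S"
  shows "perm_x w p = (\<Sum>e\<in>S.
    Poly_Mapping.single (Poly_Mapping.map_key (inv w) e) (Poly_Mapping.lookup p e))"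
  unfolding perm_x_def
  by (rule sum.mono_neutral_left) (use assms in \<open>auto simp: in_keys_iff\<close>)

lemma perm_x_add: "perm_x w (p + q) = perm_x w p + perm_x w q"
proof -
  let ?S = "Poly_Mapping.keys p \<union> Poly_Mapping.keys q"
  have "Poly_Mapping.keys (p + q) \<subseteq> ?S"
    by (rule Poly_Mapping.keys_add)
  then show ?thesis
    by (simp add: perm_x_sum_superset[of ?S] lookup_add single_add sum.distrib)
qed

lemma perm_x_single:
  "perm_x w (Poly_Mapping.single e c) = Poly_Mapping.single (Poly_Mapping.map_key (inv w) e) c"
  by (cases "c = 0") (simp_all add: perm_x_def)

lemma divided_diff_monomial_dvd:
  "Var j - Var k dvd Poly_Mapping.single e c - perm_x (Transposition.transpose j k) (Poly_Mapping.single e c)"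
    (is "_ dvd _ - perm_x ?t _")
proof (induction "\<Sum>i\<in>Poly_Mapping.keys e. Poly_Mapping.lookup e i" arbitrary: e rule: less_induct)
  case less
  show ?case
  proof (cases "e = 0")
    case True
    then show ?thesis
      by (simp add: perm_x_single map_key_zero[OF inj_inv_transpose])
  next
    case False
    then obtain i where i: "i \<in> Poly_Mapping.keys e"
      by (metis all_not_in_conv keys_eq_empty)
    define d where "d = e - Poly_Mapping.single i 1"
    have e: "e = d + Poly_Mapping.single i 1"
      by (rule poly_mapping_eqI)
        (use i in \<open>auto simp: d_def lookup_add lookup_minus lookup_single when_def in_keys_iff\<close>)
    have keys_d: "Poly_Mapping.keys d \<subseteq> Poly_Mapping.keys e"
      by (auto simp: in_keys_iff d_def lookup_minus)
    have "(\<Sum>l\<in>Poly_Mapping.keys d. Poly_Mapping.lookup d l) = (\<Sum>l\<in>Poly_Mapping.keys e. Poly_Mapping.lookup d l)"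
      by (rule sum.mono_neutral_left) (use keys_d in \<open>auto simp: in_keys_iff\<close>)
    also have "\<dots> < (\<Sum>l\<in>Poly_Mapping.keys e. Poly_Mapping.lookup e l)"
      by (rule sum_strict_mono_ex1)
        (use i in \<open>auto simp: e lookup_add intro!: bexI[of _ i]\<close>)
    finally have IH: "Var j - Var k dvd Poly_Mapping.single d c - perm_x ?t (Poly_Mapping.single d c)"
      by (rule less.hyps)
    have sing: "Poly_Mapping.map_key (inv ?t) (Poly_Mapping.single i (1::nat)) = Poly_Mapping.single (?t i) 1"
      using map_key_single[OF inj_inv_transpose, of j k "?t i" "1::nat"] by simp
    have S: "Poly_Mapping.single e c = Poly_Mapping.single d c * Var i"
      by (simp add: e Var_def mult_single)
    have P: "perm_x ?t (Poly_Mapping.single e c) = perm_x ?t (Poly_Mapping.single d c) * Var (?t i)"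
      unfolding perm_x_single Var_def mult_single
      by (subst e) (simp only: map_key_plus[OF inj_inv_transpose] sing mult_1_right)
    have V: "Var j - Var k dvd Var i - Var (?t i)"
      using dvd_minus_iff[of "Var j - Var k" "Var j - Var k"]
      by (auto simp: Transposition.transpose_def)
    have "Poly_Mapping.single e c - perm_x ?t (Poly_Mapping.single e c) =
        (Poly_Mapping.single d c - perm_x ?t (Poly_Mapping.single d c)) * Var i
        + perm_x ?t (Poly_Mapping.single d c) * (Var i - Var (?t i))"
      unfolding P unfolding S by (simp add: algebra_simps)
    then show ?thesis
      using IH V by simp
  qed
qed

lemma divided_diff_dvd: "Var j - Var k dvd p - perm_x (Transposition.transpose j k) p"
proof (induction p rule: update_induct)
  case const
  then show ?case by (simp add: perm_x_def)
next
  case (update f a b)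
  have u: "Poly_Mapping.update a b f = f + Poly_Mapping.single a b"
    by (rule poly_mapping_eqI)
      (use update in \<open>auto simp: lookup_update lookup_add lookup_single when_def in_keys_iff\<close>)
  have "Var j - Var k dvd (f - perm_x (Transposition.transpose j k) f) +
    (Poly_Mapping.single a b - perm_x (Transposition.transpose j k) (Poly_Mapping.single a b))"
    by (intro dvd_add update divided_diff_monomial_dvd)
  then show ?case
    by (simp add: u perm_x_add algebra_simps)
qed

lemma divided_diff:
  assumes "j \<noteq> k"
  shows "(Var j - Var k) * divided_diff j k p = p - perm_x (Transposition.transpose j k) p"
proof -
  have "Poly_Mapping.lookup (Var j) (Poly_Mapping.single j 1) \<noteq>
      Poly_Mapping.lookup (Var k) (Poly_Mapping.single j 1)"
    using assms by (auto simp: Var_def lookup_single when_def dest!: arg_cong[where f = "\<lambda>e. Poly_Mapping.lookup e j"])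
  then have nz: "Var j - Var k \<noteq> 0"
    by auto
  obtain q where "p - perm_x (Transposition.transpose j k) p = (Var j - Var k) * q"
    using divided_diff_dvd[of j k p] by (elim dvdE)
  then have "\<exists>!q. (Var j - Var k) * q = p - perm_x (Transposition.transpose j k) p"
    using nz by (intro ex1I[of _ q]) auto
  then show ?thesis
    unfolding divided_diff_def by (rule theI')
qed

definition dunkl :: "nat \<Rightarrow> complex \<Rightarrow> nat \<Rightarrow> mpoly \<Rightarrow> mpoly" where
  "dunkl N \<beta> j p = partial_deriv j p + Const \<beta> * (\<Sum>k\<in>{1..N} - {j}. divided_diff j k p)"

section \<open>Superpolynomials\<close>

text \<open>\<open>A :: superpoly\<close> stands for \<open>\<Sum>\<^sub>I \<theta>\<^sub>I A\<^sub>I(x)\<close> with \<open>A\<^sub>I = lookup A I\<close> and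
  \<open>\<theta>\<^sub>I = \<theta>\<^bsub>i\<^sub>1\<^esub> \<cdots> \<theta>\<^bsub>i\<^sub>m\<^esub>\<close> for \<open>I = {i\<^sub>1 < \<cdots> < i\<^sub>m}\<close>. Operators \<open>T\<close> that involve only the
  \<open>x\<close>'s act on a superpolynomial by \<open>Poly_Mapping.map T\<close>.\<close>

type_synonym superpoly = "nat set \<Rightarrow>\<^sub>0 mpoly"

definition super_scale :: "complex \<Rightarrow> superpoly \<Rightarrow> superpoly" where
  "super_scale c A = Poly_Mapping.map (\<lambda>p. Const c * p) A"

definition superpolynomials :: "nat \<Rightarrow> superpoly set" where
  "superpolynomials N = {A. \<forall>I\<in>Poly_Mapping.keys A. I \<subseteq> {1..N} \<and>
     (\<forall>e\<in>Poly_Mapping.keys (Poly_Mapping.lookup A I). Poly_Mapping.keys e \<subseteq> {1..N})}"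

text \<open>The substitution \<open>\<theta>\<^sub>i \<mapsto> \<theta>\<^bsub>w i\<^esub>\<close> maps \<open>\<theta>\<^sub>I\<close> to
  \<open>\<theta>\<^bsub>w i\<^sub>1\<^esub> \<cdots> \<theta>\<^bsub>w i\<^sub>m\<^esub> = \<plusminus>\<theta>\<^bsub>w(I)\<^esub>\<close>; the sign counts the anticommutations needed to sort
  the factors, i.e. the inversions of \<open>w\<close> on \<open>I\<close>.\<close>

definition theta_sign :: "(nat \<Rightarrow> nat) \<Rightarrow> nat set \<Rightarrow> complex" where
  "theta_sign w I = (-1) ^ card {(i, j). i \<in> I \<and> j \<in> I \<and> i < j \<and> w j < w i}"

definition perm_theta :: "(nat \<Rightarrow> nat) \<Rightarrow> superpoly \<Rightarrow> superpoly" where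
  "perm_theta w A = (\<Sum>I\<in>Poly_Mapping.keys A.
     Poly_Mapping.single (w ` I) (Const (theta_sign w I) * Poly_Mapping.lookup A I))"

definition super_perm :: "(nat \<Rightarrow> nat) \<Rightarrow> superpoly \<Rightarrow> superpoly" where
  "super_perm w A = perm_theta w (Poly_Mapping.map (perm_x w) A)"

definition symmetric_superpolys :: "nat \<Rightarrow> superpoly set" where
  "symmetric_superpolys N = {f \<in> superpolynomials N.
     \<forall>i\<in>{1..N}. \<forall>j\<in>{1..N}. super_perm (Transposition.transpose i j) f = f}"

section \<open>Superpartitions\<close>

text \<open>The pair \<open>([\<Lambda>\<^sub>1, \<dots>, \<Lambda>\<^sub>m], [\<Lambda>\<^bsub>m+1\<^esub>, \<dots>, \<Lambda>\<^sub>N])\<close>.\<close>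

type_synonym superpartition = "nat list \<times> nat list"

definition superpartitions :: "nat \<Rightarrow> superpartition set" where
  "superpartitions N = {(as, bs). length as + length bs = N \<and>
     sorted_wrt (>) as \<and> sorted_wrt (\<ge>) bs}"

definition sp_entries :: "superpartition \<Rightarrow> nat list" where
  "sp_entries \<Lambda> = fst \<Lambda> @ snd \<Lambda>"

definition fermion_number :: "superpartition \<Rightarrow> nat" where
  "fermion_number \<Lambda> = length (fst \<Lambda>)"

definition sp_degree :: "superpartition \<Rightarrow> nat" where
  "sp_degree \<Lambda> = sum_list (sp_entries \<Lambda>)"

definition sp_star :: "superpartition \<Rightarrow> nat list" where
  "sp_star \<Lambda> = rev (sort (sp_entries \<Lambda>))"

definition partial_sums_le :: "nat list \<Rightarrow> nat list \<Rightarrow> bool" where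
  "partial_sums_le as bs \<longleftrightarrow> (\<forall>k. sum_list (take k as) \<le> sum_list (take k bs))"

definition sp_dominance_le :: "superpartition \<Rightarrow> superpartition \<Rightarrow> bool" where
  "sp_dominance_le \<Omega> \<Lambda> \<longleftrightarrow>
     sp_degree \<Omega> = sp_degree \<Lambda> \<and> fermion_number \<Omega> = fermion_number \<Lambda> \<and>
     (partial_sums_le (sp_star \<Omega>) (sp_star \<Lambda>) \<and> sp_star \<Omega> \<noteq> sp_star \<Lambda> \<or>
      sp_star \<Omega> = sp_star \<Lambda> \<and> partial_sums_le (sp_entries \<Omega>) (sp_entries \<Lambda>))"

definition sp_dominance_less :: "superpartition \<Rightarrow> superpartition \<Rightarrow> bool" where
  "sp_dominance_less \<Omega> \<Lambda> \<longleftrightarrow> sp_dominance_le \<Omega> \<Lambda> \<and> \<Omega> \<noteq> \<Lambda>"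

definition u_le :: "superpartition \<Rightarrow> superpartition \<Rightarrow> bool" where
  "u_le \<Omega> \<Lambda> \<longleftrightarrow> \<Omega> = \<Lambda> \<or> (\<exists>n\<ge>1. int (sp_degree \<Omega>) = int (sp_degree \<Lambda>) - 2 * int n)"

definition u_less :: "superpartition \<Rightarrow> superpartition \<Rightarrow> bool" where
  "u_less \<Omega> \<Lambda> \<longleftrightarrow> u_le \<Omega> \<Lambda> \<and> \<Omega> \<noteq> \<Lambda>"

section \<open>Monomial and Jack superpolynomials\<close>

text \<open>Entries that do not occur contribute \<open>0! = 1\<close> to \<open>f\<^sub>\<Lambda>\<close>. The list of entries is
  indexed from \<open>0\<close>, the variables from \<open>1\<close>.\<close>

definition sp_f :: "superpartition \<Rightarrow> nat" where
  "sp_f \<Lambda> = (\<Prod>i\<in>set (snd \<Lambda>). fact (count_list (snd \<Lambda>) i))"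

definition monomial_super :: "nat \<Rightarrow> superpartition \<Rightarrow> superpoly" where
  "monomial_super N \<Lambda> = super_scale (1 / of_nat (sp_f \<Lambda>))
     (\<Sum>\<sigma> | \<sigma> permutes {1..N}. super_perm \<sigma>
        (Poly_Mapping.single {1..fermion_number \<Lambda>} (\<Prod>i\<in>{1..N}. Var i ^ (sp_entries \<Lambda> ! (i - 1)))))"

text \<open>Iterated integral \<open>\<Prod>\<^sub>j (1/(2\<pi>\<i>) \<ointegral> dx\<^sub>j/x\<^sub>j)\<close>, \<open>j = 1, \<dots>, N\<close>, over the unit circle.\<close>

fun torus_integral :: "nat \<Rightarrow> ((nat \<Rightarrow> complex) \<Rightarrow> complex) \<Rightarrow> complex" where
  "torus_integral 0 F = F (\<lambda>_. 1)"
| "torus_integral (Suc n) F = torus_integral n (\<lambda>x.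
     1 / (2 * of_real pi * \<i>) * contour_integral (circlepath 0 1) (\<lambda>z. F (x(Suc n := z)) / z))"

definition super_inner :: "nat \<Rightarrow> nat \<Rightarrow> superpoly \<Rightarrow> superpoly \<Rightarrow> complex" where
  "super_inner N \<beta> A B = (\<Sum>I\<in>Pow {1..N}. torus_integral N (\<lambda>x.
     (\<Prod>(k, l)\<in>{(k, l). k \<in> {1..N} \<and> l \<in> {1..N} \<and> k \<noteq> l}. (1 - x k / x l) ^ \<beta>) *
     cnj (eval_mpoly (Poly_Mapping.lookup A I) x) * eval_mpoly (Poly_Mapping.lookup B I) x))"

text \<open>The properties characterising the family of Jack superpolynomials \<open>J\<^sub>\<Lambda>(x, \<theta>; 1/\<beta>)\<close> in
  \<open>N\<close> variables.\<close>

definition jack_family :: "nat \<Rightarrow> nat \<Rightarrow> (superpartition \<Rightarrow> superpoly) \<Rightarrow> bool" where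
  "jack_family N \<beta> J \<longleftrightarrow>
     (\<forall>\<Lambda>\<in>superpartitions N. J \<Lambda> \<in> symmetric_superpolys N) \<and>
     (\<forall>\<Lambda>\<in>superpartitions N. \<forall>\<Omega>\<in>superpartitions N.
        \<Lambda> \<noteq> \<Omega> \<longrightarrow> super_inner N \<beta> (J \<Lambda>) (J \<Omega>) = 0) \<and>
     (\<forall>\<Lambda>\<in>superpartitions N. \<exists>t. J \<Lambda> = monomial_super N \<Lambda> +
        (\<Sum>\<Omega> | \<Omega> \<in> superpartitions N \<and> sp_dominance_less \<Omega> \<Lambda>.
           super_scale (t \<Omega>) (monomial_super N \<Omega>)))"

section \<open>Operators\<close>

definition laplacian :: "nat \<Rightarrow> complex \<Rightarrow> superpoly \<Rightarrow> superpoly" where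
  "laplacian N \<beta> A = (\<Sum>j\<in>{1..N}. Poly_Mapping.map (\<lambda>p. dunkl N \<beta> j (dunkl N \<beta> j p)) A)"

definition euler :: "nat \<Rightarrow> superpoly \<Rightarrow> superpoly" where
  "euler N A = (\<Sum>j\<in>{1..N}. Poly_Mapping.map (\<lambda>p. Var j * partial_deriv j p) A)"

text \<open>\<open>exp(c L)\<close> for a locally nilpotent \<open>L\<close>: \<open>Sum_any\<close> sums the finitely many nonzero terms.\<close>

definition exp_op :: "complex \<Rightarrow> (superpoly \<Rightarrow> superpoly) \<Rightarrow> superpoly \<Rightarrow> superpoly" where
  "exp_op c L A = Sum_any (\<lambda>n. super_scale (c ^ n / fact n) ((L ^^ n) A))"

definition rational_H1 :: "nat \<Rightarrow> complex \<Rightarrow> complex \<Rightarrow> superpoly \<Rightarrow> superpoly" where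
  "rational_H1 N \<beta> \<omega> A = exp_op (- (1 / (4 * \<omega>))) (laplacian N \<beta>)
     (euler N (exp_op (1 / (4 * \<omega>)) (laplacian N \<beta>) A))"

definition gen_hermite ::
    "nat \<Rightarrow> complex \<Rightarrow> complex \<Rightarrow> (superpartition \<Rightarrow> superpoly) \<Rightarrow> superpartition \<Rightarrow> superpoly" where
  "gen_hermite N \<beta> \<omega> J \<Lambda> = exp_op (- (1 / (4 * \<omega>))) (laplacian N \<beta>) (J \<Lambda>)"

section \<open>Bases indexed by superpartitions\<close>

lemma lookup_super_scale:
  "Poly_Mapping.lookup (super_scale c A) I = Const c * Poly_Mapping.lookup A I"
  by (simp add: super_scale_def Poly_Mapping.map.rep_eq when_def)

interpretation superpoly: vector_space super_scale
proof
  show "super_scale a (x + y) = super_scale a x + super_scale a y" for a x y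
    by (rule poly_mapping_eqI) (simp add: lookup_super_scale lookup_add algebra_simps)
  show "super_scale (a + b) x = super_scale a x + super_scale b x" for a b x
    by (rule poly_mapping_eqI)
      (simp add: lookup_super_scale lookup_add Const_def single_add algebra_simps)
  show "super_scale a (super_scale b x) = super_scale (a * b) x" for a b x
    by (rule poly_mapping_eqI)
      (simp add: lookup_super_scale Const_def mult_single mult.assoc[symmetric])
  show "super_scale 1 x = x" for x
    by (rule poly_mapping_eqI) (simp add: lookup_super_scale Const_def)
qed

definition indexed_basis :: "superpartition set \<Rightarrow> (superpartition \<Rightarrow> superpoly) \<Rightarrow> superpoly set \<Rightarrow> bool" where
  "indexed_basis S G V \<longleftrightarrow> inj_on G S \<and> \<not> superpoly.dependent (G ` S) \<and> superpoly.span (G ` S) = V"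

end

(*
  The superpartitions of degree d index the monomial superpolynomials of degree d, and the coefficient
  of theta_1 ... theta_m x^Lambda separates them; since the Jack superpolynomials are unitriangular
  over the monomials, those of degree d form a basis of the symmetric superpolynomials homogeneous of
  degree d. The operator Delta commutes with the symmetric group and lowers the degree by 2, so
  exp(c Delta) J_Lambda - J_Lambda is a combination of J_Omega with Omega <_u Lambda, and the Hermite
  family is again a unitriangular basis. Conjugation turns its eigenvalue equation into that of the
  Euler operator. Conversely, for G as in the theorem, exp(Delta / (4 omega)) G_Lambda is an Euler
  eigenvector of eigenvalue |Lambda| and differs from J_Lambda only by terms of lower degree, so it
  equals J_Lambda.
*)
theory Submission
  imports Defs
begin

text \<open>The divided difference is given only as a quotient by x_j - x_k. Its linearity,
  equivariance and homogeneity are therefore extracted from the defining equation by cancellation,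
  while the other operators are read off coefficient by coefficient. Homogeneity is taken for
  arbitrary integer weights. With all weights 1 it is the degree; with weight 1 exactly on the
  variables beyond N, degree 0 says that those variables are absent. One lemma thus shows both that
  Delta lowers the degree by 2 and that it stays within N variables. The orders are only partial, so
  triangularity is expressed through a natural-valued rank: the number of strictly smaller
  superpartitions for dominance, the degree for the u-order. The exponential is a finite sum on
  vectors killed by a power of Delta. Symmetric superpolynomials are such vectors, being
  combinations of homogeneous Jack superpolynomials. Uniqueness rests on a spectral gap: on the span
  of the J_Omega with Omega <_u Lambda the Euler operator does not have the eigenvalue
  |Lambda|.\<close>

abbreviation lookup :: "('a \<Rightarrow>\<^sub>0 'b::zero) \<Rightarrow> 'a \<Rightarrow> 'b" where
  "lookup \<equiv> Poly_Mapping.lookup"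

abbreviation keys :: "('a \<Rightarrow>\<^sub>0 'b::zero) \<Rightarrow> 'a set" where
  "keys \<equiv> Poly_Mapping.keys"

abbreviation single :: "'a \<Rightarrow> 'b \<Rightarrow> 'a \<Rightarrow>\<^sub>0 'b::zero" where
  "single \<equiv> Poly_Mapping.single"

section \<open>Polynomials\<close>

text \<open>Updating at a fresh key is the same as adding a singleton, so additive identities need
  checking on monomials only.\<close>

lemma poly_mapping_add_induct [case_names zero single add]:
  fixes p :: "'a \<Rightarrow>\<^sub>0 'b::comm_monoid_add"
  assumes "P 0" "\<And>e c. P (single e c)" "\<And>p q. P p \<Longrightarrow> P q \<Longrightarrow> P (p + q)"
  shows "P p"
proof (induction p rule: update_induct)
  case const
  show ?case by (fact assms(1))
next
  case (update f a b)
  have "Poly_Mapping.update a b f = f + single a b"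
    by (rule poly_mapping_eqI)
      (use update in \<open>auto simp: lookup_update lookup_add lookup_single when_def in_keys_iff\<close>)
  then show ?case
    using assms update by simp
qed

section \<open>Coefficients under multiplication, differentiation and substitution\<close>

lemma lookup_map_zero: "f 0 = 0 \<Longrightarrow> lookup (Poly_Mapping.map f p) k = f (lookup p k)"
  by (simp add: Poly_Mapping.map.rep_eq when_def)

lemma lookup_map_key: "inj f \<Longrightarrow> lookup (Poly_Mapping.map_key f e) k = lookup e (f k)"
  by (simp add: Poly_Mapping.map_key.rep_eq)

text \<open>Subtraction of exponents is truncated, so \<open>e - d\<close> is meaningful only
  together with the divisibility condition on \<open>e\<close>.\<close>

lemma lookup_mult_single:
  fixes q :: mpoly
  shows "lookup (single d c * q) e = (if \<exists>f. e = d + f then c * lookup q (e - d) else 0)"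
proof (induction q rule: poly_mapping_add_induct)
  case (single f b)
  show ?case
  proof (cases "\<exists>f. e = d + f")
    case True
    then show ?thesis
      by (auto simp: mult_single lookup_single when_def)
  next
    case False
    then show ?thesis
      by (auto simp: mult_single lookup_single when_def)
  qed
qed (auto simp: lookup_add distrib_left)

lemma lookup_Const_mult: "lookup (Const c * p) e = c * lookup p e"
  by (simp add: Const_def lookup_mult_single)

lemma lookup_Var_mult:
  "lookup (Var i * p) e = (if lookup e i = 0 then 0 else lookup p (e - single i 1))"
proof -
  have "(\<exists>f. e = single i (1::nat) + f) \<longleftrightarrow> lookup e i \<noteq> 0"
  proof
    assume "lookup e i \<noteq> 0"
    then have "e = single i 1 + (e - single i 1)"
      by (intro poly_mapping_eqI) (auto simp: lookup_add lookup_minus lookup_single when_def)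
    then show "\<exists>f. e = single i (1::nat) + f" ..
  qed (auto simp: lookup_add)
  then show ?thesis
    by (auto simp: Var_def lookup_mult_single)
qed

lemma lookup_partial_deriv:
  "lookup (partial_deriv i p) e = of_nat (Suc (lookup e i)) * lookup p (e + single i 1)"
proof -
  \<comment> \<open>Truncated subtraction also fixes every exponent without x_i. The factor
    \<open>of_nat (lookup d i)\<close> kills those terms, hence the second conjunct.\<close>
  have *: "d - single i 1 = e \<and> lookup d i \<noteq> 0 \<longleftrightarrow> d = e + single i (1::nat)" for d
  proof
    assume "d - single i 1 = e \<and> lookup d i \<noteq> 0"
    then show "d = e + single i (1::nat)"
      by (intro poly_mapping_eqI) (auto simp: lookup_add lookup_minus lookup_single when_def)
  qed (auto simp: lookup_add)
  have "lookup (partial_deriv i p) e =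
      (\<Sum>d\<in>keys p. (of_nat (lookup d i) * lookup p d when d - single i 1 = e))"
    by (simp add: partial_deriv_def lookup_sum lookup_single)
  also have "\<dots> = (\<Sum>d\<in>keys p. if d = e + single i 1 then of_nat (lookup d i) * lookup p d else 0)"
  proof (rule sum.cong[OF refl])
    fix d
    show "(of_nat (lookup d i) * lookup p d when d - single i 1 = e) =
        (if d = e + single i 1 then of_nat (lookup d i) * lookup p d else 0)"
      using *[of d] by (cases "lookup d i = 0"; cases "d - single i 1 = e") (simp_all only: simp_thms when_simps if_True if_False of_nat_0 mult_zero_left if_cancel)
  qed
  also have "\<dots> = of_nat (Suc (lookup e i)) * lookup p (e + single i 1)"
    by (simp add: in_keys_iff lookup_add)
  finally show ?thesis .
qed

text \<open>The definition moves exponents by \<open>inv w\<close>, so reading off a coefficient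
  pulls back along \<open>w\<close> itself. This form keeps inverses out of the coefficient
  computations below.\<close>

lemma lookup_perm_x:
  assumes "bij w"
  shows "lookup (perm_x w p) e = lookup p (Poly_Mapping.map_key w e)"
proof -
  have inj: "inj w" "inj (inv w)"
    using assms by (auto simp: bij_is_inj bij_imp_bij_inv)
  have *: "Poly_Mapping.map_key (inv w) d = e \<longleftrightarrow> d = Poly_Mapping.map_key w e" for d :: "nat \<Rightarrow>\<^sub>0 nat"
    unfolding poly_mapping_eq_iff fun_eq_iff lookup_map_key[OF inj(1)] lookup_map_key[OF inj(2)]
    using assms by (metis bij_inv_eq_iff)
  show ?thesis
  proof (induction p rule: poly_mapping_add_induct)
    case zero
    show ?case by (simp add: perm_x_def)
  next
    case (single d c)
    show ?case by (simp add: perm_x_single lookup_single *)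
  qed (simp add: perm_x_add lookup_add)
qed

lemma perm_x_zero [simp]: "perm_x w 0 = 0"
  by (simp add: perm_x_def)

lemma perm_x_diff: "bij w \<Longrightarrow> perm_x w (p - q) = perm_x w p - perm_x w q"
  by (rule poly_mapping_eqI) (simp add: lookup_perm_x lookup_minus)

lemma perm_x_Const_mult: "bij w \<Longrightarrow> perm_x w (Const c * p) = Const c * perm_x w p"
  by (rule poly_mapping_eqI) (simp add: lookup_perm_x lookup_Const_mult)

lemma perm_x_sum: "perm_x w (sum f A) = (\<Sum>a\<in>A. perm_x w (f a))"
  by (induction A rule: infinite_finite_induct) (simp_all add: perm_x_add)

lemma perm_x_comp:
  assumes "bij v" "bij w"
  shows "perm_x v (perm_x w p) = perm_x (v \<circ> w) p"
  by (rule poly_mapping_eqI)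
    (use assms in \<open>simp add: lookup_perm_x bij_comp map_key_compose bij_is_inj\<close>)

lemma map_key_add_single:
  assumes "bij w"
  shows "Poly_Mapping.map_key w (e + single (w i) c) = Poly_Mapping.map_key w e + single i (c :: nat)"
  using assms by (simp add: map_key_plus bij_is_inj)

lemma map_key_minus_single:
  assumes "bij w"
  shows "Poly_Mapping.map_key w (e - single (w i) c) = Poly_Mapping.map_key w e - single i (c :: nat)"
  by (rule poly_mapping_eqI)
    (use assms in \<open>auto simp: lookup_map_key bij_is_inj lookup_minus lookup_single when_def inj_eq[OF bij_is_inj]\<close>)

lemma perm_x_Var_mult: "bij w \<Longrightarrow> perm_x w (Var i * p) = Var (w i) * perm_x w p"
  by (rule poly_mapping_eqI)
    (auto simp: lookup_perm_x lookup_Var_mult lookup_map_key bij_is_inj map_key_minus_single)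

lemma perm_x_partial_deriv: "bij w \<Longrightarrow> perm_x w (partial_deriv i p) = partial_deriv (w i) (perm_x w p)"
  by (rule poly_mapping_eqI)
    (simp add: lookup_perm_x lookup_partial_deriv lookup_map_key bij_is_inj map_key_add_single)

section \<open>Equivariance of divided differences and Dunkl operators\<close>

lemma Var_diff_nonzero:
  assumes "j \<noteq> k"
  shows "Var j - Var k \<noteq> 0"
proof
  assume "Var j - Var k = 0"
  then have "single (single j (1::nat)) (1::complex) = single (single k 1) 1"
    by (simp add: Var_def)
  then have "single j (1::nat) = single k 1"
    by (metis keys_single one_neq_zero singleton_inject)
  then show False
    using assms by (metis keys_single one_neq_zero singleton_inject)
qed

text \<open>Polynomials have no zero divisors, so any candidate satisfying the defining equation is
  the quotient. Linearity and equivariance are proved by exhibiting a candidate.\<close>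

lemma divided_diff_unique:
  assumes "j \<noteq> k" "(Var j - Var k) * q = p - perm_x (Transposition.transpose j k) p"
  shows "divided_diff j k p = q"
  using divided_diff[OF assms(1), of p] Var_diff_nonzero[OF assms(1)] assms(2)
  by (metis mult_cancel_left)

lemma divided_diff_add:
  "j \<noteq> k \<Longrightarrow> divided_diff j k (p + q) = divided_diff j k p + divided_diff j k q"
  by (rule divided_diff_unique) (simp_all add: perm_x_add distrib_left divided_diff)

lemma divided_diff_Const_mult:
  assumes "j \<noteq> k"
  shows "divided_diff j k (Const c * p) = Const c * divided_diff j k p"
proof (rule divided_diff_unique[OF assms])
  have "(Var j - Var k) * (Const c * divided_diff j k p) = Const c * ((Var j - Var k) * divided_diff j k p)"
    by (simp add: mult.left_commute)
  then show "(Var j - Var k) * (Const c * divided_diff j k p) =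
      Const c * p - perm_x (Transposition.transpose j k) (Const c * p)"
    using assms by (simp add: divided_diff perm_x_Const_mult right_diff_distrib)
qed

text \<open>Conjugating the transposition of \<open>j\<close> and \<open>k\<close> by
  \<open>w\<close> gives the transposition of \<open>w j\<close> and \<open>w k\<close>; applying
  \<open>w\<close> to the defining equation then exhibits the quotient.\<close>

lemma perm_x_divided_diff:
  assumes "bij w" "j \<noteq> k"
  shows "perm_x w (divided_diff j k p) = divided_diff (w j) (w k) (perm_x w p)"
proof (rule divided_diff_unique[symmetric])
  show "w j \<noteq> w k"
    using assms by (metis bij_is_inj inj_eq)
  have "w \<circ> Transposition.transpose j k = Transposition.transpose (w j) (w k) \<circ> w"
    using assms by (auto simp: fun_eq_iff Transposition.transpose_def inj_eq[OF bij_is_inj])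
  then have "perm_x w (perm_x (Transposition.transpose j k) p) =
      perm_x (Transposition.transpose (w j) (w k)) (perm_x w p)"
    using assms by (simp add: perm_x_comp)
  moreover have "perm_x w ((Var j - Var k) * divided_diff j k p) =
      perm_x w (p - perm_x (Transposition.transpose j k) p)"
    using assms by (simp add: divided_diff)
  ultimately show "(Var (w j) - Var (w k)) * perm_x w (divided_diff j k p) =
      perm_x w p - perm_x (Transposition.transpose (w j) (w k)) (perm_x w p)"
    using assms by (simp add: left_diff_distrib perm_x_diff perm_x_Var_mult)
qed

lemma dunkl_add: "dunkl N \<beta> j (p + q) = dunkl N \<beta> j p + dunkl N \<beta> j q"
proof -
  have "partial_deriv j (p + q) = partial_deriv j p + partial_deriv j q"
    by (rule poly_mapping_eqI) (simp add: lookup_partial_deriv lookup_add distrib_left)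
  moreover have "(\<Sum>k\<in>{1..N} - {j}. divided_diff j k (p + q)) =
      (\<Sum>k\<in>{1..N} - {j}. divided_diff j k p) + (\<Sum>k\<in>{1..N} - {j}. divided_diff j k q)"
    unfolding sum.distrib[symmetric] by (rule sum.cong) (auto simp: divided_diff_add)
  ultimately show ?thesis
    by (simp add: dunkl_def distrib_left)
qed

lemma dunkl_zero [simp]: "dunkl N \<beta> j 0 = 0"
  using dunkl_add[of N \<beta> j 0 0] by simp

lemma dunkl_Const_mult: "dunkl N \<beta> j (Const c * p) = Const c * dunkl N \<beta> j p"
proof -
  have "partial_deriv j (Const c * p) = Const c * partial_deriv j p"
    by (rule poly_mapping_eqI) (simp add: lookup_partial_deriv lookup_Const_mult)
  moreover have "(\<Sum>k\<in>{1..N} - {j}. divided_diff j k (Const c * p)) =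
      Const c * (\<Sum>k\<in>{1..N} - {j}. divided_diff j k p)"
    unfolding sum_distrib_left by (rule sum.cong) (auto simp: divided_diff_Const_mult)
  ultimately show ?thesis
    by (simp add: dunkl_def distrib_left mult.left_commute)
qed

text \<open>A permutation of the first N indices carries the range of \<open>k\<close> for
  \<open>j\<close> onto the range for \<open>w j\<close>, so the sum of divided differences is
  merely reindexed.\<close>

lemma perm_x_dunkl:
  assumes "w permutes {1..N}"
  shows "perm_x w (dunkl N \<beta> j p) = dunkl N \<beta> (w j) (perm_x w p)"
proof -
  have w: "bij w"
    using assms by (rule permutes_bij)
  have "(\<Sum>k\<in>{1..N} - {j}. perm_x w (divided_diff j k p)) =
      (\<Sum>k\<in>{1..N} - {j}. divided_diff (w j) (w k) (perm_x w p))"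
    using w by (intro sum.cong) (auto simp: perm_x_divided_diff)
  also have "\<dots> = (\<Sum>k\<in>w ` ({1..N} - {j}). divided_diff (w j) k (perm_x w p))"
    using w by (subst sum.reindex) (auto intro: inj_on_subset[OF bij_is_inj])
  also have "w ` ({1..N} - {j}) = {1..N} - {w j}"
    using assms by (simp add: image_set_diff permutes_inj permutes_image)
  finally show ?thesis
    using w by (simp add: dunkl_def perm_x_add perm_x_partial_deriv perm_x_Const_mult perm_x_sum)
qed

subsection \<open>Weighted homogeneity\<close>

text \<open>The weights depend on the variable because the same lemmas serve for the total degree
  and for the absence of surplus variables. Integer values allow degrees to drop below zero, which
  is how nilpotency is detected.\<close>

definition weight :: "(nat \<Rightarrow> int) \<Rightarrow> (nat \<Rightarrow>\<^sub>0 nat) \<Rightarrow> int" where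
  "weight c e = (\<Sum>i\<in>keys e. c i * int (lookup e i))"

definition homogeneous :: "(nat \<Rightarrow> int) \<Rightarrow> int \<Rightarrow> mpoly \<Rightarrow> bool" where
  "homogeneous c d p \<longleftrightarrow> (\<forall>e. lookup p e \<noteq> 0 \<longrightarrow> weight c e = d)"

lemma weight_superset:
  assumes "finite S" "keys e \<subseteq> S"
  shows "weight c e = (\<Sum>i\<in>S. c i * int (lookup e i))"
  unfolding weight_def by (rule sum.mono_neutral_left) (use assms in \<open>auto simp: in_keys_iff\<close>)

lemma weight_add: "weight c (e + f) = weight c e + weight c f"
proof -
  have "weight c g = (\<Sum>i\<in>keys e \<union> keys f. c i * int (lookup g i))" if "g \<in> {e, f, e + f}" for g
    using that keys_add[of e f] by (intro weight_superset) auto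
  then show ?thesis
    by (simp add: lookup_add sum.distrib algebra_simps)
qed

lemma weight_single [simp]: "weight c (single i n) = c i * int n"
  by (simp add: weight_def)

lemma weight_map_key:
  assumes "bij w" "\<And>i. c (w i) = c i"
  shows "weight c (Poly_Mapping.map_key w e) = weight c e"
proof -
  have "weight c (Poly_Mapping.map_key w e) = (\<Sum>i\<in>w -` keys e. c (w i) * int (lookup e (w i)))"
    using assms by (simp add: weight_def keys_map_key lookup_map_key bij_is_inj)
  also have "\<dots> = (\<Sum>i\<in>w ` (w -` keys e). c i * int (lookup e i))"
    using assms by (subst sum.reindex) (auto intro: inj_on_subset[OF bij_is_inj])
  also have "w ` (w -` keys e) = keys e"
    using assms by (simp add: bij_is_surj surj_image_vimage_eq)
  finally show ?thesis
    by (simp add: weight_def)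
qed

lemma homogeneous_zero [simp]: "homogeneous c d 0"
  by (simp add: homogeneous_def)

lemma homogeneous_add: "homogeneous c d p \<Longrightarrow> homogeneous c d q \<Longrightarrow> homogeneous c d (p + q)"
  unfolding homogeneous_def lookup_add by (metis add.right_neutral)

lemma homogeneous_diff: "homogeneous c d p \<Longrightarrow> homogeneous c d q \<Longrightarrow> homogeneous c d (p - q)"
  unfolding homogeneous_def lookup_minus by (metis diff_zero)

lemma homogeneous_sum: "(\<And>a. a \<in> A \<Longrightarrow> homogeneous c d (f a)) \<Longrightarrow> homogeneous c d (sum f A)"
  by (induction A rule: infinite_finite_induct) (auto intro: homogeneous_add)

lemma homogeneous_Const_mult: "homogeneous c d p \<Longrightarrow> homogeneous c d (Const a * p)"
  by (simp add: homogeneous_def lookup_Const_mult)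

lemma homogeneous_perm_x:
  assumes "bij w" "\<And>i. c (w i) = c i" "homogeneous c d p"
  shows "homogeneous c d (perm_x w p)"
  using assms weight_map_key[of w c, OF assms(1,2)]
  unfolding homogeneous_def by (metis lookup_perm_x)

lemma homogeneous_partial_deriv:
  assumes "homogeneous c d p"
  shows "homogeneous c (d - c i) (partial_deriv i p)"
  unfolding homogeneous_def
proof (intro allI impI)
  fix e assume "lookup (partial_deriv i p) e \<noteq> 0"
  then have "weight c (e + single i 1) = d"
    using assms by (simp add: lookup_partial_deriv homogeneous_def)
  then show "weight c e = d - c i"
    by (simp add: weight_add)
qed

definition homogeneous_part :: "(nat \<Rightarrow> int) \<Rightarrow> int \<Rightarrow> mpoly \<Rightarrow> mpoly" where
  "homogeneous_part c d p = Poly_Mapping.mapp (\<lambda>e a. if weight c e = d then a else 0) p"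

lemma lookup_homogeneous_part:
  "lookup (homogeneous_part c d p) e = (if weight c e = d then lookup p e else 0)"
  by (simp add: homogeneous_part_def lookup_mapp when_def in_keys_iff)

lemma homogeneous_part_diff:
  "homogeneous_part c d (p - q) = homogeneous_part c d p - homogeneous_part c d q"
  by (rule poly_mapping_eqI) (simp add: lookup_homogeneous_part lookup_minus)

lemma homogeneous_part_Var_mult:
  "homogeneous_part c d (Var i * p) = Var i * homogeneous_part c (d - c i) p"
proof (rule poly_mapping_eqI)
  fix e
  have "weight c (e - single i 1) = weight c e - c i" if "lookup e i \<noteq> 0"
  proof -
    have "e = (e - single i 1) + single i 1"
      using that by (intro poly_mapping_eqI) (auto simp: lookup_add lookup_minus lookup_single when_def)
    then have "weight c e = weight c (e - single i 1) + weight c (single i 1)"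
      by (metis weight_add)
    then show ?thesis by simp
  qed
  then show "lookup (homogeneous_part c d (Var i * p)) e = lookup (Var i * homogeneous_part c (d - c i) p) e"
    by (auto simp: lookup_homogeneous_part lookup_Var_mult)
qed

text \<open>The homogeneous components of the quotient are the quotients of the components.\<close>

lemma homogeneous_divided_diff:
  assumes "j \<noteq> k" "c j = c k" "homogeneous c d p"
  shows "homogeneous c (d - c j) (divided_diff j k p)"
proof -
  let ?q = "divided_diff j k p" and ?r = "p - perm_x (Transposition.transpose j k) p"
  have r: "homogeneous c d ?r"
    using assms by (intro homogeneous_diff homogeneous_perm_x) (auto simp: Transposition.transpose_def)
  have "homogeneous_part c n ?q = 0" if "n \<noteq> d - c j" for n
  proof -
    \<comment> \<open>Both variables have the same weight, so multiplication by their difference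
      shifts all components by the same amount.\<close>
    have "(Var j - Var k) * homogeneous_part c n ?q = homogeneous_part c (n + c j) ((Var j - Var k) * ?q)"
      using assms by (simp add: left_diff_distrib homogeneous_part_diff homogeneous_part_Var_mult)
    also have "\<dots> = homogeneous_part c (n + c j) ?r"
      using assms by (simp add: divided_diff)
    also have "\<dots> = 0"
      using r that by (intro poly_mapping_eqI) (auto simp: lookup_homogeneous_part homogeneous_def)
    finally show ?thesis
      using Var_diff_nonzero[OF assms(1)] by simp
  qed
  then show ?thesis
    unfolding homogeneous_def by (metis lookup_homogeneous_part lookup_zero)
qed

text \<open>A common weight \<open>g\<close> on the first N variables makes the derivative and all
  divided differences shift the degree equally. It is 1 for the degree and 0 for the surplus
  variables.\<close>

lemma homogeneous_dunkl:
  assumes "\<And>i. i \<in> {1..N} \<Longrightarrow> c i = g" "j \<in> {1..N}" "homogeneous c d p"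
  shows "homogeneous c (d - g) (dunkl N \<beta> j p)"
  unfolding dunkl_def
proof (intro homogeneous_add homogeneous_Const_mult homogeneous_sum)
  have j: "c j = g"
    using assms by blast
  show "homogeneous c (d - g) (partial_deriv j p)"
    using homogeneous_partial_deriv[OF assms(3), of j] by (simp add: j)
  fix k assume "k \<in> {1..N} - {j}"
  then show "homogeneous c (d - g) (divided_diff j k p)"
    using homogeneous_divided_diff[of j k c d p] assms j by simp
qed

section \<open>The action of the symmetric group\<close>

text \<open>As a product over pairs, the sign of a composition can be compared factor by
  factor.\<close>

lemma theta_sign_eq_prod:
  assumes "finite I"
  shows "theta_sign w I = (\<Prod>(i, j)\<in>{(i, j). i \<in> I \<and> j \<in> I \<and> i < j}. if w j < w i then - 1 else 1)"
proof -
  let ?P = "{(i, j). i \<in> I \<and> j \<in> I \<and> i < j}"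
  have fin: "finite ?P"
    by (rule finite_subset[of _ "I \<times> I"]) (use assms in auto)
  have "theta_sign w I = (\<Prod>x\<in>{x \<in> ?P. w (snd x) < w (fst x)}. - 1)"
    by (auto simp: theta_sign_def intro!: arg_cong[where f = "\<lambda>A. (-1) ^ card A"])
  also have "\<dots> = (\<Prod>(i, j)\<in>?P. if w j < w i then - 1 else 1)"
    using fin by (simp only: prod.inter_filter) (simp add: case_prod_unfold)
  finally show ?thesis .
qed

text \<open>A pair inverted by both \<open>v\<close> and \<open>w\<close> contributes two signs that cancel.\<close>

lemma theta_sign_comp:
  assumes "finite I" "bij v" "bij w"
  shows "theta_sign (w \<circ> v) I = theta_sign w (v ` I) * theta_sign v I"
proof -
  let ?P = "\<lambda>I. {(i, j). i \<in> I \<and> j \<in> I \<and> i < (j :: nat)}"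
  let ?s = "\<lambda>w (i :: nat, j :: nat). if w j < (w i :: nat) then - 1 else (1 :: complex)"
  \<comment> \<open>The image of an increasing pair is sorted again, which makes this a bijection
    from the increasing pairs of I to those of the image of I under \<open>v\<close>.\<close>
  let ?g = "\<lambda>v (i :: nat, j :: nat). (min (v i) (v j), max (v i) (v j :: nat))"
  have v: "v i = v j \<longleftrightarrow> i = j" "inv v (v i) = i" "v (inv v i) = i" for i j
    using assms by (auto simp: bij_is_inj inj_eq bij_is_surj surj_f_inv_f)
  have w: "w i = w j \<longleftrightarrow> i = j" for i j
    using assms by (auto simp: bij_is_inj inj_eq)
  have "theta_sign (w \<circ> v) I = (\<Prod>x\<in>?P I. ?s (w \<circ> v) x)"
    using theta_sign_eq_prod[OF assms(1)] .
  also have "\<dots> = (\<Prod>x\<in>?P I. ?s w (?g v x) * ?s v x)"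
  proof (rule prod.cong[OF refl])
    fix x
    assume "x \<in> ?P I"
    then obtain i j where x: "x = (i, j)" "i < j"
      by auto
    then have "v i \<noteq> v j" "w (v i) \<noteq> w (v j)"
      by (auto simp: v w)
    then show "?s (w \<circ> v) x = ?s w (?g v x) * ?s v x"
      by (cases "v i < v j") (auto simp: x min_def max_def)
  qed
  also have "\<dots> = (\<Prod>x\<in>?P I. ?s w (?g v x)) * theta_sign v I"
    using theta_sign_eq_prod[OF assms(1), of v] by (simp add: prod.distrib)
  also have "(\<Prod>x\<in>?P I. ?s w (?g v x)) = (\<Prod>x\<in>?P (v ` I). ?s w x)"
  proof (rule prod.reindex_bij_witness[where i = "?g (inv v)" and j = "?g v"])
    fix x assume "x \<in> ?P I"
    then obtain i j where x: "x = (i, j)" "i \<in> I" "j \<in> I" "i < j"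
      by auto
    then have "v i < v j \<or> v j < v i"
      using v(1)[of i j] by linarith
    then show "?g (inv v) (?g v x) = x" "?g v x \<in> ?P (v ` I)"
      using x by (auto simp: min_def max_def v(2))
  next
    fix x assume "x \<in> ?P (v ` I)"
    then obtain i j where x: "x = (v i, v j)" "i \<in> I" "j \<in> I" "v i < v j"
      by auto
    then have "i < j \<or> j < i"
      using v(1)[of i j] by linarith
    then show "?g v (?g (inv v) x) = x" "?g (inv v) x \<in> ?P I"
      using x by (auto simp: min_def max_def v(2))
  qed simp
  also have "\<dots> = theta_sign w (v ` I)"
    using assms by (intro theta_sign_eq_prod[symmetric]) simp
  finally show ?thesis .
qed

lemma theta_sign_eq_1: "(\<And>i. i \<in> I \<Longrightarrow> w i = i) \<Longrightarrow> theta_sign w I = 1"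
proof -
  assume "\<And>i. i \<in> I \<Longrightarrow> w i = i"
  then have "{(i, j). i \<in> I \<and> j \<in> I \<and> i < j \<and> w j < w i} = {}"
    by fastforce
  then show ?thesis
    by (simp only: theta_sign_def card.empty power_0)
qed

text \<open>No index lies between two neighbours, so their exchange inverts no other pair.\<close>

lemma theta_sign_adjacent:
  assumes "i \<in> I" "Suc i \<in> I"
  shows "theta_sign (Transposition.transpose i (Suc i)) I = - 1"
proof -
  have "{(k, l). k \<in> I \<and> l \<in> I \<and> k < l \<and>
      Transposition.transpose i (Suc i) l < Transposition.transpose i (Suc i) k} = {(i, Suc i)}"
    using assms by (auto simp: Transposition.transpose_def split: if_splits)
  then show ?thesis
    by (simp add: theta_sign_def)
qed

section \<open>Simultaneous permutation of commuting and anticommuting variables\<close>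

lemma superpoly_eqI: "(\<And>I. lookup A I = lookup B I) \<Longrightarrow> (A :: superpoly) = B"
  by (rule poly_mapping_eqI)

text \<open>Every index set is an image under the bijection \<open>w\<close>, and it is at images
  that \<open>lookup_super_perm\<close> gives the component.\<close>

lemma super_eqI_image:
  assumes "bij w" "\<And>I. lookup A (w ` I) = lookup B (w ` I)"
  shows "(A :: superpoly) = B"
  by (rule poly_mapping_eqI) (metis assms bij_is_surj image_f_inv_f)

lemma lookup_super_perm:
  assumes "bij w"
  shows "lookup (super_perm w A) (w ` I) = Const (theta_sign w I) * perm_x w (lookup A I)"
proof -
  let ?B = "Poly_Mapping.map (perm_x w) A"
  have "lookup (super_perm w A) (w ` I) =
      (\<Sum>K\<in>keys ?B. if K = I then Const (theta_sign w K) * lookup ?B K else 0)"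
    unfolding super_perm_def perm_theta_def lookup_sum
    by (rule sum.cong) (use assms in \<open>auto simp: lookup_single when_def inj_image_eq_iff bij_is_inj\<close>)
  also have "\<dots> = Const (theta_sign w I) * lookup ?B I"
    by (simp add: in_keys_iff)
  finally show ?thesis
    by (simp add: lookup_map_zero)
qed

lemma super_perm_add: "bij w \<Longrightarrow> super_perm w (A + B) = super_perm w A + super_perm w B"
  by (rule super_eqI_image[of w])
    (simp_all add: lookup_super_perm lookup_add perm_x_add distrib_left)

lemma super_perm_zero [simp]: "bij w \<Longrightarrow> super_perm w 0 = 0"
  by (rule super_eqI_image[of w]) (simp_all add: lookup_super_perm)

lemma super_perm_sum: "bij w \<Longrightarrow> super_perm w (sum f S) = (\<Sum>a\<in>S. super_perm w (f a))"
  by (induction S rule: infinite_finite_induct) (simp_all add: super_perm_add)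

lemma super_perm_scale: "bij w \<Longrightarrow> super_perm w (super_scale c A) = super_scale c (super_perm w A)"
  by (rule super_eqI_image[of w])
    (simp_all add: lookup_super_perm lookup_super_scale perm_x_Const_mult mult.left_commute)

lemma super_perm_single:
  "bij w \<Longrightarrow> super_perm w (single I p) = single (w ` I) (Const (theta_sign w I) * perm_x w p)"
  by (rule super_eqI_image[of w])
    (simp_all add: lookup_super_perm lookup_single when_def inj_image_eq_iff bij_is_inj)

lemma Const_mult_Const: "Const a * (Const b * p) = Const (a * b) * p"
  by (simp add: Const_def mult_single mult.assoc[symmetric])

lemma Const_1_mult [simp]: "Const 1 * p = p"
  by (simp add: Const_def)

lemma super_perm_id [simp]: "super_perm id A = A"
proof (rule superpoly_eqI)
  fix I
  have "perm_x id p = p" for p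
    by (rule poly_mapping_eqI) (simp only: lookup_perm_x bij_id map_key_id id_def[symmetric] map_key_id[folded id_def])
  then show "lookup (super_perm id A) I = lookup A I"
    using lookup_super_perm[of id A I] by (simp add: theta_sign_eq_1)
qed

text \<open>Index sets range over all sets of naturals, but the sign counts inversions by
  \<open>card\<close>, which collapses to 0 on infinite sets. Multiplicativity of the sign is
  therefore used on finite sets, whence the condition on the support.\<close>

lemma super_perm_comp:
  assumes "bij v" "bij w" "\<And>I. I \<in> keys A \<Longrightarrow> finite I"
  shows "super_perm v (super_perm w A) = super_perm (v \<circ> w) A"
proof (rule super_eqI_image[of "v \<circ> w"])
  show vw: "bij (v \<circ> w)"
    using assms by (simp add: bij_comp)
  fix I
  show "lookup (super_perm v (super_perm w A)) ((v \<circ> w) ` I) = lookup (super_perm (v \<circ> w) A) ((v \<circ> w) ` I)"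
  proof (cases "I \<in> keys A")
    case True
    then have "theta_sign (v \<circ> w) I = theta_sign v (w ` I) * theta_sign w I"
      using assms by (intro theta_sign_comp) auto
    then show ?thesis
      unfolding lookup_super_perm[OF vw]
      unfolding image_comp[symmetric]
      using assms by (simp add: lookup_super_perm perm_x_Const_mult Const_mult_Const perm_x_comp)
  next
    case False
    then have "lookup A I = 0"
      by (simp add: in_keys_iff)
    then show ?thesis
      unfolding lookup_super_perm[OF vw]
      unfolding image_comp[symmetric]
      using assms by (simp add: lookup_super_perm)
  qed
qed

section \<open>Homogeneous superpolynomials and the restriction to N variables\<close>

definition super_homogeneous :: "(nat \<Rightarrow> int) \<Rightarrow> int \<Rightarrow> superpoly \<Rightarrow> bool" where
  "super_homogeneous c d A \<longleftrightarrow> (\<forall>I. homogeneous c d (lookup A I))"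

text \<open>Involving only the first \<open>N\<close> variables means being homogeneous of degree \<open>0\<close> in the others.\<close>

abbreviation outside :: "nat \<Rightarrow> nat \<Rightarrow> int" where
  "outside N i \<equiv> (if i \<in> {1..N} then 0 else 1)"

lemma weight_outside: "weight (outside N) e = 0 \<longleftrightarrow> keys e \<subseteq> {1..N}"
  unfolding weight_def by (subst sum_nonneg_eq_0_iff) (auto simp: in_keys_iff)

lemma superpolynomials_iff:
  "A \<in> superpolynomials N \<longleftrightarrow> keys A \<subseteq> Pow {1..N} \<and> super_homogeneous (outside N) 0 A"
proof -
  have "super_homogeneous (outside N) 0 A \<longleftrightarrow>
      (\<forall>I\<in>keys A. \<forall>e\<in>keys (lookup A I). keys e \<subseteq> {1..N})"
    unfolding super_homogeneous_def homogeneous_def weight_outside in_keys_iff Ball_def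
    by (metis lookup_zero)
  then show ?thesis
    unfolding superpolynomials_def by blast
qed

lemma super_homogeneous_zero [simp]: "super_homogeneous c d 0"
  by (simp add: super_homogeneous_def)

lemma super_homogeneous_add:
  "super_homogeneous c d A \<Longrightarrow> super_homogeneous c d B \<Longrightarrow> super_homogeneous c d (A + B)"
  by (simp add: super_homogeneous_def lookup_add homogeneous_add)

lemma super_homogeneous_scale: "super_homogeneous c d A \<Longrightarrow> super_homogeneous c d (super_scale a A)"
  by (simp add: super_homogeneous_def lookup_super_scale homogeneous_Const_mult)

lemma super_homogeneous_sum:
  "(\<And>a. a \<in> S \<Longrightarrow> super_homogeneous c d (f a)) \<Longrightarrow> super_homogeneous c d (sum f S)"
  by (induction S rule: infinite_finite_induct) (auto intro: super_homogeneous_add)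

lemma super_homogeneous_super_perm:
  assumes "bij w" "\<And>i. c (w i) = c i" "super_homogeneous c d A"
  shows "super_homogeneous c d (super_perm w A)"
  unfolding super_homogeneous_def
proof
  fix K
  have "w ` (inv w ` K) = K"
    using assms by (simp add: image_f_inv_f bij_is_surj)
  then show "homogeneous c d (lookup (super_perm w A) K)"
    using lookup_super_perm[OF assms(1), of A "inv w ` K"] assms
    by (auto simp: super_homogeneous_def intro!: homogeneous_Const_mult homogeneous_perm_x)
qed

lemma subspace_superpolynomials: "superpoly.subspace (superpolynomials N)"
proof (rule superpoly.subspaceI)
  show "0 \<in> superpolynomials N"
    by (simp add: superpolynomials_iff)
  show "A + B \<in> superpolynomials N" if "A \<in> superpolynomials N" "B \<in> superpolynomials N" for A B
    using that keys_add[of A B] by (auto simp: superpolynomials_iff super_homogeneous_add)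
  show "super_scale c A \<in> superpolynomials N" if "A \<in> superpolynomials N" for c A
    using that by (auto simp: superpolynomials_iff super_homogeneous_scale in_keys_iff lookup_super_scale)
qed

lemma super_perm_superpolynomials:
  assumes "w permutes {1..N}" "A \<in> superpolynomials N"
  shows "super_perm w A \<in> superpolynomials N"
proof -
  have w: "bij w"
    using assms by (simp add: permutes_bij)
  have "K \<subseteq> {1..N}" if "K \<in> keys (super_perm w A)" for K
  proof -
    have K: "w ` (inv w ` K) = K"
      using w by (simp add: image_f_inv_f bij_is_surj)
    then have "inv w ` K \<in> keys A"
      using that lookup_super_perm[OF w, of A "inv w ` K"] by (auto simp: in_keys_iff)
    then have "inv w ` K \<subseteq> {1..N}"
      using assms by (auto simp: superpolynomials_iff)
    then show ?thesis
      by (metis K assms(1) image_mono permutes_image)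
  qed
  moreover have "super_homogeneous (outside N) 0 (super_perm w A)"
    using assms w permutes_in_image[OF assms(1)]
    by (intro super_homogeneous_super_perm) (auto simp: superpolynomials_iff)
  ultimately show ?thesis
    by (auto simp: superpolynomials_iff)
qed

lemma finite_keys_superpolynomials: "A \<in> superpolynomials N \<Longrightarrow> I \<in> keys A \<Longrightarrow> finite I"
  by (auto simp: superpolynomials_iff intro: finite_subset)

text \<open>The definition tests transpositions. These generate the permutations of {1..N}, and the
  composition law carries invariance along.\<close>

lemma symmetric_superpolys_iff:
  "f \<in> symmetric_superpolys N \<longleftrightarrow>
    f \<in> superpolynomials N \<and> (\<forall>w. w permutes {1..N} \<longrightarrow> super_perm w f = f)"
proof (intro iffI conjI allI impI)
  assume f: "f \<in> symmetric_superpolys N"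
  then show fN: "f \<in> superpolynomials N"
    by (simp add: symmetric_superpolys_def)
  fix w :: "nat \<Rightarrow> nat"
  assume "w permutes {1..N}"
  then show "super_perm w f = f"
    using finite_atLeastAtMost
  proof (induction rule: permutes_induct)
    case (swap a b p)
    have "super_perm (Transposition.transpose a b \<circ> p) f =
        super_perm (Transposition.transpose a b) (super_perm p f)"
      using fN permutes_bij[OF swap.hyps(4)] by (simp add: super_perm_comp finite_keys_superpolynomials)
    also have "\<dots> = f"
      using swap f by (simp add: symmetric_superpolys_def)
    finally show ?case .
  qed (simp_all add: super_perm_id[unfolded id_def])
next
  assume "f \<in> superpolynomials N \<and> (\<forall>w. w permutes {1..N} \<longrightarrow> super_perm w f = f)"
  then show "f \<in> symmetric_superpolys N"
    by (simp add: symmetric_superpolys_def permutes_swap_id)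
qed

lemma subspace_symmetric_superpolys: "superpoly.subspace (symmetric_superpolys N)"
  using subspace_superpolynomials[of N]
  by (simp add: superpoly.subspace_def symmetric_superpolys_iff super_perm_add super_perm_scale permutes_bij)

lemma lookup_symmetric:
  assumes "f \<in> symmetric_superpolys N" "w permutes {1..N}"
  shows "lookup f (w ` I) = Const (theta_sign w I) * perm_x w (lookup f I)"
  using assms lookup_super_perm[of w f I] by (simp add: symmetric_superpolys_iff permutes_bij)

section \<open>The operator Delta on symmetric superpolynomials\<close>

lemma lookup_laplacian:
  "lookup (laplacian N \<beta> A) I = (\<Sum>j\<in>{1..N}. dunkl N \<beta> j (dunkl N \<beta> j (lookup A I)))"
  by (simp add: laplacian_def lookup_sum lookup_map_zero)

lemma laplacian_add: "laplacian N \<beta> (A + B) = laplacian N \<beta> A + laplacian N \<beta> B"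
  by (rule superpoly_eqI) (simp add: lookup_laplacian lookup_add dunkl_add sum.distrib)

lemma laplacian_scale: "laplacian N \<beta> (super_scale c A) = super_scale c (laplacian N \<beta> A)"
  by (rule superpoly_eqI) (simp add: lookup_laplacian lookup_super_scale dunkl_Const_mult sum_distrib_left)

lemma super_homogeneous_laplacian:
  assumes "\<And>i. i \<in> {1..N} \<Longrightarrow> c i = g" "super_homogeneous c d A"
  shows "super_homogeneous c (d - 2 * g) (laplacian N \<beta> A)"
  unfolding super_homogeneous_def lookup_laplacian
proof (intro allI homogeneous_sum)
  fix I j assume j: "j \<in> {1..N}"
  have "homogeneous c (d - g - g) (dunkl N \<beta> j (dunkl N \<beta> j (lookup A I)))"
    using assms j by (intro homogeneous_dunkl) (auto simp: super_homogeneous_def)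
  then show "homogeneous c (d - 2 * g) (dunkl N \<beta> j (dunkl N \<beta> j (lookup A I)))"
    by (simp add: algebra_simps)
qed

text \<open>A permutation turns the j-th Dunkl operator into the one with index \<open>w j\<close>;
  a single one is not invariant, but the sum of their squares is.\<close>

lemma super_perm_laplacian:
  assumes "w permutes {1..N}"
  shows "super_perm w (laplacian N \<beta> A) = laplacian N \<beta> (super_perm w A)"
proof (rule super_eqI_image[of w])
  show w: "bij w"
    using assms by (rule permutes_bij)
  fix I
  let ?D = "\<lambda>j p. dunkl N \<beta> j (dunkl N \<beta> j p)"
  have "(\<Sum>j\<in>{1..N}. ?D (w j) (perm_x w (lookup A I))) = (\<Sum>j\<in>{1..N}. ?D j (perm_x w (lookup A I)))"
    using sum.permute[OF assms, of "\<lambda>j. ?D j (perm_x w (lookup A I))"] by (simp add: o_def)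
  then show "lookup (super_perm w (laplacian N \<beta> A)) (w ` I) = lookup (laplacian N \<beta> (super_perm w A)) (w ` I)"
    using w by (simp add: lookup_laplacian lookup_super_perm perm_x_sum perm_x_dunkl[OF assms]
        dunkl_Const_mult sum_distrib_left)
qed

lemma laplacian_symmetric:
  assumes "A \<in> symmetric_superpolys N"
  shows "laplacian N \<beta> A \<in> symmetric_superpolys N"
proof -
  have A: "keys A \<subseteq> Pow {1..N}" "super_homogeneous (outside N) 0 A"
    using assms by (auto simp: symmetric_superpolys_iff superpolynomials_iff)
  have "keys (laplacian N \<beta> A) \<subseteq> keys A"
    by (auto simp: in_keys_iff lookup_laplacian)
  \<comment> \<open>The first N variables have weight 0 here, so the degree in the remaining ones
    stays 0. The unevaluated \<open>0 - 2 * 0\<close> matches the general shape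
    \<open>d - 2 * g\<close>.\<close>
  moreover have "super_homogeneous (outside N) (0 - 2 * 0) (laplacian N \<beta> A)"
    using A by (intro super_homogeneous_laplacian) auto
  ultimately show ?thesis
    using A assms by (auto simp: symmetric_superpolys_iff superpolynomials_iff super_perm_laplacian)
qed

section \<open>Triangular families in vector spaces\<close>

context vector_space
begin

text \<open>Independence is a notion for sets and does not see repeated members of a family. Adding
  injectivity makes it equivalent to the condition on coefficients indexed by \<open>S\<close>, the
  form that triangular arguments need.\<close>

lemma independent_family_iff:
  "inj_on G S \<and> independent (G ` S) \<longleftrightarrow>
    (\<forall>F a. finite F \<longrightarrow> F \<subseteq> S \<longrightarrow> (\<Sum>i\<in>F. scale (a i) (G i)) = 0 \<longrightarrow> (\<forall>i\<in>F. a i = 0))"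
    (is "_ \<longleftrightarrow> ?R")
proof
  assume L: "inj_on G S \<and> independent (G ` S)"
  show ?R
  proof (intro allI impI ballI)
    fix F a i
    assume F: "finite F" "F \<subseteq> S" "(\<Sum>i\<in>F. scale (a i) (G i)) = 0" "i \<in> F"
    have inj: "inj_on G F"
      using L F inj_on_subset by blast
    have "(\<Sum>v\<in>G ` F. scale (a (inv_into F G v)) v) = (\<Sum>i\<in>F. scale (a i) (G i))"
      using inj by (simp add: sum.reindex)
    then have "a (inv_into F G (G i)) = 0"
      using independentD[of "G ` S" "G ` F" "\<lambda>v. a (inv_into F G v)" "G i"] L F by auto
    then show "a i = 0"
      using inj F by simp
  qed
next
  assume R: ?R
  have inj: "inj_on G S"
  proof (rule inj_onI, rule ccontr)
    fix i j assume ij: "i \<in> S" "j \<in> S" "G i = G j" "i \<noteq> j"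
    \<comment> \<open>A repeated vector would give the nontrivial relation with coefficients 1 and
      -1.\<close>
    then have "(\<Sum>k\<in>{i, j}. scale (if k = i then 1 else - 1) (G k)) = 0"
      by simp
    then show False
      using R[rule_format, of "{i, j}" "\<lambda>k. if k = i then 1 else - 1" i] ij by simp
  qed
  moreover have "independent (G ` S)"
    unfolding independent_explicit_finite_subsets
  proof (intro allI impI ballI)
    fix T u v
    assume T: "T \<subseteq> G ` S" "finite T" "(\<Sum>v\<in>T. scale (u v) v) = 0" "v \<in> T"
    then obtain F where F: "F \<subseteq> S" "finite F" "T = G ` F"
      using finite_subset_image[OF T(2,1)] by auto
    have "(\<Sum>i\<in>F. scale (u (G i)) (G i)) = 0"
      using T(3) inj_on_subset[OF inj F(1)] unfolding F(3) by (simp add: sum.reindex)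
    then show "u v = 0"
      using R[rule_format, OF F(2,1), of "\<lambda>i. u (G i)"] T(4) unfolding F(3) by auto
  qed
  ultimately show "inj_on G S \<and> independent (G ` S)" ..
qed

text \<open>Since \<open>D\<close> decreases the rank \<open>\<mu>\<close>, each \<open>M i\<close>
  can be solved for by induction on the rank. A rank instead of an order lets the lemma serve both
  dominance and the u-order.\<close>

lemma span_unitriangular:
  fixes \<mu> :: "'i \<Rightarrow> nat"
  assumes D: "\<And>i. i \<in> S \<Longrightarrow> D i \<subseteq> S" "\<And>i j. i \<in> S \<Longrightarrow> j \<in> D i \<Longrightarrow> \<mu> j < \<mu> i"
    and G: "\<And>i. i \<in> S \<Longrightarrow> G i = M i + (\<Sum>j\<in>D i. scale (t i j) (M j))"
  shows "span (G ` S) = span (M ` S)"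
proof (rule antisym; rule span_minimal[OF _ subspace_span]; rule image_subsetI)
  fix i assume i: "i \<in> S"
  show "G i \<in> span (M ` S)"
    using D(1)[OF i] i unfolding G[OF i]
    by (intro span_add span_sum span_scale) (auto intro: span_base)
next
  fix i assume "i \<in> S"
  then show "M i \<in> span (G ` S)"
  proof (induction "\<mu> i" arbitrary: i rule: less_induct)
    case less
    have "M j \<in> span (G ` S)" if "j \<in> D i" for j
      using less that D by blast
    then have "G i - (\<Sum>j\<in>D i. scale (t i j) (M j)) \<in> span (G ` S)"
      using less.prems by (intro span_diff[OF span_base] span_sum span_scale) auto
    then show ?case
      using G[OF less.prems] by simp
  qed
qed

text \<open>Among the indices with nonzero coefficient in a relation, take \<open>k\<close> of
  maximal rank. Then \<open>M k\<close> enters only through \<open>G k\<close>, with coefficient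
  \<open>a k\<close>, so independence of \<open>M\<close> forces \<open>a k = 0\<close>.\<close>

lemma independent_unitriangular:
  fixes \<mu> :: "'i \<Rightarrow> nat"
  assumes D: "\<And>i. i \<in> S \<Longrightarrow> D i \<subseteq> S" "\<And>i. i \<in> S \<Longrightarrow> finite (D i)"
      "\<And>i j. i \<in> S \<Longrightarrow> j \<in> D i \<Longrightarrow> \<mu> j < \<mu> i"
    and G: "\<And>i. i \<in> S \<Longrightarrow> G i = M i + (\<Sum>j\<in>D i. scale (t i j) (M j))"
    and M: "inj_on M S \<and> independent (M ` S)"
  shows "inj_on G S \<and> independent (G ` S)"
  unfolding independent_family_iff
proof (intro allI impI, rule ccontr)
  fix F a
  assume F: "finite F" "F \<subseteq> S" "(\<Sum>i\<in>F. scale (a i) (G i)) = 0" and "\<not> (\<forall>i\<in>F. a i = 0)"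
  then have "finite {i \<in> F. a i \<noteq> 0}" "{i \<in> F. a i \<noteq> 0} \<noteq> {}"
    by auto
  then obtain k where k: "k \<in> F" "a k \<noteq> 0" and max: "\<And>i. i \<in> F \<Longrightarrow> a i \<noteq> 0 \<Longrightarrow> \<mu> i \<le> \<mu> k"
    using Max_in[of "\<mu> ` {i \<in> F. a i \<noteq> 0}"] Max_ge[of "\<mu> ` {i \<in> F. a i \<noteq> 0}"]
    by (smt (verit) finite_imageI image_iff image_is_empty mem_Collect_eq)
  \<comment> \<open>\<open>C\<close> is a finite set containing every index of an \<open>M j\<close>
    that occurs. \<open>b\<close> is the unitriangular matrix of the family, the identity plus the
    strictly lower entries.\<close>
  define C where "C = F \<union> (\<Union>i\<in>F. D i)"
  define b where "b i j = (if j = i then 1 else 0) + (if j \<in> D i then t i j else 0)" for i j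
  have C: "finite C" "C \<subseteq> S" "F \<subseteq> C"
    using F D by (auto simp: C_def)
  have "G i = (\<Sum>j\<in>C. scale (b i j) (M j))" if "i \<in> F" for i
  proof -
    have "D i \<subseteq> C"
      using that by (auto simp: C_def)
    then have "(\<Sum>j\<in>D i. scale (t i j) (M j)) = (\<Sum>j\<in>C. scale (if j \<in> D i then t i j else 0) (M j))"
      using C by (intro sum.mono_neutral_cong_left) auto
    moreover have "M i = (\<Sum>j\<in>C. scale (if j = i then 1 else 0) (M j))"
      using C that by (subst sum.remove[of _ i]) auto
    ultimately show ?thesis
      using G[of i] that F by (auto simp: b_def scale_left_distrib sum.distrib)
  qed
  then have "(\<Sum>i\<in>F. scale (a i) (G i)) = (\<Sum>i\<in>F. \<Sum>j\<in>C. scale (a i * b i j) (M j))"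
    by (simp add: scale_sum_right)
  also have "\<dots> = (\<Sum>j\<in>C. scale (\<Sum>i\<in>F. a i * b i j) (M j))"
    by (subst sum.swap) (simp add: scale_sum_left)
  finally have "(\<Sum>j\<in>C. scale (\<Sum>i\<in>F. a i * b i j) (M j)) = 0"
    using F(3) by simp
  from M[unfolded independent_family_iff, rule_format, OF C(1,2) this]
  have "(\<Sum>i\<in>F. a i * b i k) = 0"
    using C(3) k(1) by blast
  \<comment> \<open>An index \<open>i\<close> with \<open>k\<close> in \<open>D i\<close> would have
    rank above that of \<open>k\<close>, contradicting maximality.\<close>
  moreover have "a i * b i k = (if i = k then a k else 0)" if "i \<in> F" for i
  proof (cases "a i = 0")
    case False
    then show ?thesis
      using that max[of i] D(3)[of i k] F(2) by (force simp: b_def)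
  qed (use k in auto)
  ultimately have "(\<Sum>i\<in>F. if i = k then a k else 0) = 0"
    by simp
  then show False
    using F k by simp
qed

end

section \<open>The monomial basis\<close>

definition sp_exponent :: "superpartition \<Rightarrow> (nat \<Rightarrow>\<^sub>0 nat)" where
  "sp_exponent \<Lambda> = (\<Sum>i\<in>{1..length (sp_entries \<Lambda>)}. single i (sp_entries \<Lambda> ! (i - 1)))"

lemma length_sp_entries: "\<Lambda> \<in> superpartitions N \<Longrightarrow> length (sp_entries \<Lambda>) = N"
  by (auto simp: superpartitions_def sp_entries_def)

lemma lookup_sp_exponent:
  "lookup (sp_exponent \<Lambda>) i = (if i \<in> {1..length (sp_entries \<Lambda>)} then sp_entries \<Lambda> ! (i - 1) else 0)"
  by (simp add: sp_exponent_def lookup_sum lookup_single when_def)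

lemma weight_sp_exponent: "weight (\<lambda>_. 1) (sp_exponent \<Lambda>) = int (sp_degree \<Lambda>)"
proof -
  have "weight c (sum f A) = (\<Sum>a\<in>A. weight c (f a))" for c :: "nat \<Rightarrow> int" and f :: "nat \<Rightarrow> _" and A
  proof (induction A rule: infinite_finite_induct)
    case (insert x F)
    then show ?case by (simp add: weight_add)
  qed (simp_all add: weight_def)
  then have "weight (\<lambda>_. 1) (sp_exponent \<Lambda>) =
      (\<Sum>i\<in>{1..length (sp_entries \<Lambda>)}. int (sp_entries \<Lambda> ! (i - 1)))"
    by (simp add: sp_exponent_def)
  also have "\<dots> = int (sp_degree \<Lambda>)"
    by (simp add: sp_degree_def sum_list_sum_nth sum.atLeast1_atMost_eq lessThan_atLeast0)
  finally show ?thesis .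
qed

lemma prod_Var_power: "finite A \<Longrightarrow> (\<Prod>i\<in>A. Var i ^ g i) = single (\<Sum>i\<in>A. single i (g i)) 1"
proof (induction A rule: finite_induct)
  case (insert x F)
  have "Var x ^ n = single (single x n) 1" for n
    by (induction n) (simp_all add: Var_def mult_single single_add[symmetric])
  then show ?case
    using insert by (simp add: mult_single)
qed simp

lemma monomial_super_eq:
  assumes "\<Lambda> \<in> superpartitions N"
  shows "monomial_super N \<Lambda> = super_scale (1 / of_nat (sp_f \<Lambda>))
     (\<Sum>\<sigma> | \<sigma> permutes {1..N}. super_perm \<sigma> (single {1..fermion_number \<Lambda>} (single (sp_exponent \<Lambda>) 1)))"
  using length_sp_entries[OF assms] by (simp add: monomial_super_def prod_Var_power sp_exponent_def)

lemma monomial_super_symmetric: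
  assumes "\<Lambda> \<in> superpartitions N"
  shows "monomial_super N \<Lambda> \<in> symmetric_superpolys N"
proof -
  let ?B = "single {1..fermion_number \<Lambda>} (single (sp_exponent \<Lambda>) 1) :: superpoly"
  let ?S = "\<Sum>\<sigma> | \<sigma> permutes {1..N}. super_perm \<sigma> ?B"
  have "fermion_number \<Lambda> \<le> N"
    using assms by (auto simp: fermion_number_def superpartitions_def)
  moreover have "keys (sp_exponent \<Lambda>) \<subseteq> {1..N}"
    using length_sp_entries[OF assms] by (auto simp: in_keys_iff lookup_sp_exponent split: if_splits)
  ultimately have B: "?B \<in> superpolynomials N"
    by (auto simp: superpolynomials_def)
  then have "?S \<in> superpolynomials N"
    by (intro superpoly.subspace_sum[OF subspace_superpolynomials]) (simp add: super_perm_superpolynomials)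
  moreover have "super_perm w ?S = ?S" if w: "w permutes {1..N}" for w
  proof -
    have "super_perm w ?S = (\<Sum>\<sigma> | \<sigma> permutes {1..N}. super_perm (w \<circ> \<sigma>) ?B)"
      unfolding super_perm_sum[OF permutes_bij[OF w]]
      using w by (intro sum.cong super_perm_comp permutes_bij finite_keys_superpolynomials[OF B]) auto
    then show ?thesis
      using setum_permutations_compose_left[OF w, of "\<lambda>\<sigma>. super_perm \<sigma> ?B"] by simp
  qed
  ultimately have "?S \<in> symmetric_superpolys N"
    by (simp add: symmetric_superpolys_iff)
  then show ?thesis
    unfolding monomial_super_eq[OF assms] by (rule superpoly.subspace_scale[OF subspace_symmetric_superpolys])
qed

lemma super_homogeneous_monomial_super:
  assumes "\<Lambda> \<in> superpartitions N"
  shows "super_homogeneous (\<lambda>_. 1) (int (sp_degree \<Lambda>)) (monomial_super N \<Lambda>)"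
  unfolding monomial_super_eq[OF assms]
proof (intro super_homogeneous_scale super_homogeneous_sum super_homogeneous_super_perm)
  show "super_homogeneous (\<lambda>_. 1) (int (sp_degree \<Lambda>)) (single {1..fermion_number \<Lambda>} (single (sp_exponent \<Lambda>) 1))"
    by (auto simp: super_homogeneous_def homogeneous_def lookup_single when_def weight_sp_exponent)
qed (auto simp: permutes_bij)

text \<open>Up to nonzero factors these functionals are dual to the monomial superpolynomials, and
  together they determine a symmetric superpolynomial.\<close>

definition leading :: "superpartition \<Rightarrow> superpoly \<Rightarrow> complex" where
  "leading \<Lambda> A = lookup (lookup A {1..fermion_number \<Lambda>}) (sp_exponent \<Lambda>)"

lemma leading_scale: "leading \<Lambda> (super_scale c A) = c * leading \<Lambda> A"
  by (simp add: leading_def lookup_super_scale lookup_Const_mult)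

lemma leading_sum: "leading \<Lambda> (sum f S) = (\<Sum>a\<in>S. leading \<Lambda> (f a))"
  by (simp add: leading_def lookup_sum)

lemma leading_diff: "leading \<Lambda> (A - B) = leading \<Lambda> A - leading \<Lambda> B"
  by (simp add: leading_def lookup_minus)

lemma sorted_desc_unique:
  fixes xs :: "nat list"
  assumes "sorted_wrt (\<ge>) xs" "sorted_wrt (\<ge>) ys" "mset xs = mset ys"
  shows "xs = ys"
proof -
  have "rev xs = rev ys"
    using assms by (metis mset_rev properties_for_sort sorted_wrt_rev)
  then show ?thesis by simp
qed

text \<open>Describes a list by a block of variable indices. The offset \<open>a\<close> is 0 for
  the fermionic part and the fermion number for the bosonic part.\<close>

lemma mset_eq_image_nth: "mset xs = image_mset (\<lambda>i. xs ! (i - Suc a)) (mset_set {Suc a..a + length xs})"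
proof -
  have "bij_betw (\<lambda>i. i + Suc a) {..<length xs} {Suc a..a + length xs}"
    by (rule bij_betw_byWitness[where f' = "\<lambda>i. i - Suc a"]) auto
  then have "mset_set {Suc a..a + length xs} = image_mset (\<lambda>i. i + Suc a) (mset_set {..<length xs})"
    by (simp add: bij_betw_def image_mset_mset_set)
  moreover have "mset xs = image_mset (\<lambda>i. xs ! i) (mset_set {..<length xs})"
    by (metis map_nth mset_map mset_upt lessThan_atLeast0)
  ultimately show ?thesis
    by (simp add: image_mset.compositionality o_def)
qed

lemma mset_fst_sp_exponent:
  "mset (fst \<Lambda>) = image_mset (lookup (sp_exponent \<Lambda>)) (mset_set {1..fermion_number \<Lambda>})"
  unfolding mset_eq_image_nth[of "fst \<Lambda>" 0] fermion_number_def One_nat_def add_0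
  by (rule image_mset_cong)
    (auto simp: lookup_sp_exponent fermion_number_def sp_entries_def nth_append)

lemma mset_snd_sp_exponent:
  assumes "\<Lambda> \<in> superpartitions N"
  shows "mset (snd \<Lambda>) = image_mset (lookup (sp_exponent \<Lambda>)) (mset_set ({1..N} - {1..fermion_number \<Lambda>}))"
proof -
  have "{1..N} - {1..fermion_number \<Lambda>} = {Suc (length (fst \<Lambda>))..length (fst \<Lambda>) + length (snd \<Lambda>)}"
    using assms by (auto simp: superpartitions_def fermion_number_def)
  then show ?thesis
    unfolding mset_eq_image_nth[of "snd \<Lambda>" "length (fst \<Lambda>)"]
    by (simp only:, intro image_mset_cong)
      (auto simp: lookup_sp_exponent fermion_number_def sp_entries_def nth_append)
qed

text \<open>The permutation matches the two blocks of indices and their exponents, so both parts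
  have equal multisets of entries and, being sorted, are equal. The fermionic entries are distinct,
  so \<open>\<sigma>\<close> must fix each index of that block; hence no sign arises.\<close>

lemma sp_exponent_permuted:
  assumes \<Lambda>: "\<Lambda> \<in> superpartitions N" and \<Omega>: "\<Omega> \<in> superpartitions N" and \<sigma>: "\<sigma> permutes {1..N}"
    and image: "\<sigma> ` {1..fermion_number \<Lambda>} = {1..fermion_number \<Omega>}"
    and key: "\<And>i. lookup (sp_exponent \<Omega>) (\<sigma> i) = lookup (sp_exponent \<Lambda>) i"
  shows "\<Omega> = \<Lambda>" and "theta_sign \<sigma> {1..fermion_number \<Lambda>} = 1"
proof -
  have *: "image_mset (lookup (sp_exponent \<Omega>)) (mset_set (\<sigma> ` A)) = image_mset (lookup (sp_exponent \<Lambda>)) (mset_set A)"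
    for A
    using key permutes_inj_on[OF \<sigma>, of A] by (simp add: image_mset_mset_set[symmetric] image_mset.compositionality o_def)
  have "mset (fst \<Omega>) = mset (fst \<Lambda>)"
    unfolding mset_fst_sp_exponent image[symmetric] by (rule *)
  moreover have "\<sigma> ` ({1..N} - {1..fermion_number \<Lambda>}) = {1..N} - {1..fermion_number \<Omega>}"
    using \<sigma> image by (simp add: image_set_diff permutes_inj permutes_image)
  then have "mset (snd \<Omega>) = mset (snd \<Lambda>)"
    unfolding mset_snd_sp_exponent[OF \<Omega>] mset_snd_sp_exponent[OF \<Lambda>] by (metis *)
  ultimately show "\<Omega> = \<Lambda>"
    using \<Lambda> \<Omega> by (auto simp: superpartitions_def intro!: sorted_desc_unique elim: sorted_wrt_mono_rel[rotated])
  then have "\<sigma> i = i" if "i \<in> {1..fermion_number \<Lambda>}" for i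
  proof -
    have "\<sigma> i \<in> {1..fermion_number \<Lambda>}"
      using image that \<open>\<Omega> = \<Lambda>\<close> by auto
    moreover have "distinct (fst \<Lambda>)"
    proof -
      have "sorted_wrt (<) (rev (fst \<Lambda>))"
        using \<Lambda> by (auto simp: superpartitions_def sorted_wrt_rev)
      then show ?thesis
        by (simp add: strict_sorted_iff)
    qed
    ultimately show ?thesis
      using key[of i] that nth_eq_iff_index_eq[of "fst \<Lambda>" "\<sigma> i - 1" "i - 1"] \<open>\<Omega> = \<Lambda>\<close>
      by (auto simp: lookup_sp_exponent sp_entries_def nth_append fermion_number_def split: if_splits)
  qed
  then show "theta_sign \<sigma> {1..fermion_number \<Lambda>} = 1"
    by (rule theta_sign_eq_1)
qed

text \<open>A matching permutation could a priori contribute either sign and come from a different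
  superpartition; \<open>sp_exponent_permuted\<close> excludes both.\<close>

lemma leading_super_perm:
  assumes \<Lambda>: "\<Lambda> \<in> superpartitions N" and \<Omega>: "\<Omega> \<in> superpartitions N" and \<sigma>: "\<sigma> permutes {1..N}"
  shows "leading \<Omega> (super_perm \<sigma> (single {1..fermion_number \<Lambda>} (single (sp_exponent \<Lambda>) 1))) =
    (if \<Omega> = \<Lambda> \<and> \<sigma> ` {1..fermion_number \<Lambda>} = {1..fermion_number \<Omega>} \<and>
      Poly_Mapping.map_key \<sigma> (sp_exponent \<Omega>) = sp_exponent \<Lambda> then 1 else 0)"
proof -
  have bij: "bij \<sigma>"
    using \<sigma> by (rule permutes_bij)
  let ?c = "\<sigma> ` {1..fermion_number \<Lambda>} = {1..fermion_number \<Omega>} \<and>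
      Poly_Mapping.map_key \<sigma> (sp_exponent \<Omega>) = sp_exponent \<Lambda>"
  have "leading \<Omega> (super_perm \<sigma> (single {1..fermion_number \<Lambda>} (single (sp_exponent \<Lambda>) 1))) =
      (if ?c then theta_sign \<sigma> {1..fermion_number \<Lambda>} else 0)"
    using bij by (auto simp: leading_def super_perm_single lookup_single when_def lookup_Const_mult lookup_perm_x)
  moreover have "\<Omega> = \<Lambda> \<and> theta_sign \<sigma> {1..fermion_number \<Lambda>} = 1" if ?c
    using that sp_exponent_permuted[OF assms] bij
    by (metis bij_is_inj lookup_map_key)
  ultimately show ?thesis
    by auto
qed

lemma leading_monomial_super_other:
  assumes "\<Lambda> \<in> superpartitions N" "\<Omega> \<in> superpartitions N" "\<Omega> \<noteq> \<Lambda>"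
  shows "leading \<Omega> (monomial_super N \<Lambda>) = 0"
  using assms by (simp add: monomial_super_eq leading_scale leading_sum leading_super_perm del: One_nat_def)

text \<open>All contributions are +1 and cannot cancel: the sum counts the permutations preserving
  the fermionic block and the exponents, among them the identity. Being nonzero suffices below, so
  the value is not computed.\<close>

lemma leading_monomial_super_nonzero:
  assumes "\<Lambda> \<in> superpartitions N"
  shows "leading \<Lambda> (monomial_super N \<Lambda>) \<noteq> 0"
proof -
  let ?P = "\<lambda>\<sigma>. \<sigma> ` {1..fermion_number \<Lambda>} = {1..fermion_number \<Lambda>} \<and>
      Poly_Mapping.map_key \<sigma> (sp_exponent \<Lambda>) = sp_exponent \<Lambda>"
  have fin: "finite {\<sigma>. \<sigma> permutes {1..N}}"
    by (simp add: finite_permutations)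
  have "(\<Sum>\<sigma> | \<sigma> permutes {1..N}. leading \<Lambda> (super_perm \<sigma> (single {1..fermion_number \<Lambda>} (single (sp_exponent \<Lambda>) 1)))) =
      (\<Sum>\<sigma> | \<sigma> permutes {1..N}. if ?P \<sigma> then 1 else 0)"
    using assms by (intro sum.cong) (auto simp: leading_super_perm simp del: One_nat_def)
  also have "\<dots> = of_nat (card {\<sigma> \<in> {\<sigma>. \<sigma> permutes {1..N}}. ?P \<sigma>})"
    using fin by (simp add: sum.If_cases Int_def)
  also have "\<dots> \<noteq> 0"
  proof -
    have "id \<in> {\<sigma> \<in> {\<sigma>. \<sigma> permutes {1..N}}. ?P \<sigma>}"
      using permutes_id[of "{1..N}"] by (simp add: id_def map_key_id)
    moreover have "finite {\<sigma> \<in> {\<sigma>. \<sigma> permutes {1..N}}. ?P \<sigma>}"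
      by (rule finite_subset[OF _ fin]) blast
    ultimately have "card {\<sigma> \<in> {\<sigma>. \<sigma> permutes {1..N}}. ?P \<sigma>} \<noteq> 0"
      unfolding card_eq_0_iff by blast
    then show ?thesis
      by (simp only: of_nat_eq_0_iff simp_thms)
  qed
  finally show ?thesis
    using assms by (simp add: monomial_super_eq leading_scale leading_sum sp_f_def)
qed

lemma monomial_super_independent:
  "inj_on (monomial_super N) (superpartitions N) \<and>
    superpoly.independent (monomial_super N ` superpartitions N)"
  unfolding superpoly.independent_family_iff
proof (intro allI impI ballI)
  fix F a \<Lambda>
  assume F: "finite F" "F \<subseteq> superpartitions N"
    and zero: "(\<Sum>i\<in>F. super_scale (a i) (monomial_super N i)) = 0" and \<Lambda>: "\<Lambda> \<in> F"
  have "0 = leading \<Lambda> (\<Sum>i\<in>F. super_scale (a i) (monomial_super N i))"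
    by (simp add: zero leading_def)
  also have "\<dots> = (\<Sum>i\<in>F. a i * leading \<Lambda> (monomial_super N i))"
    by (simp add: leading_sum leading_scale)
  also have "\<dots> = (\<Sum>i\<in>F. if i = \<Lambda> then a \<Lambda> * leading \<Lambda> (monomial_super N \<Lambda>) else 0)"
    using F \<Lambda> leading_monomial_super_other[of _ N \<Lambda>] by (intro sum.cong) auto
  also have "\<dots> = a \<Lambda> * leading \<Lambda> (monomial_super N \<Lambda>)"
    using F \<Lambda> by simp
  finally show "a \<Lambda> = 0"
    using leading_monomial_super_nonzero[of \<Lambda> N] F \<Lambda> by auto
qed

text \<open>Every monomial can be permuted into the shape of a superpartition; two equal exponents among
  the first \<open>m\<close> are excluded by the sign of the transposition of two neighbours.\<close>

lemma symmetric_eq_0: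
  assumes f: "f \<in> symmetric_superpolys N"
    and lead: "\<And>\<Lambda>. \<Lambda> \<in> superpartitions N \<Longrightarrow> leading \<Lambda> f = 0"
  shows "f = 0"
proof (rule ccontr)
  assume "f \<noteq> 0"
  then obtain I where "lookup f I \<noteq> 0"
    by (metis lookup_zero poly_mapping_eqI)
  then obtain e where e: "lookup (lookup f I) e \<noteq> 0"
    by (metis lookup_zero poly_mapping_eqI)
  have supp: "I \<subseteq> {1..N}" "keys e \<subseteq> {1..N}"
    using f e \<open>lookup f I \<noteq> 0\<close>
    unfolding symmetric_superpolys_iff superpolynomials_def by (blast intro: in_keys_iff[THEN iffD2])+
  have fin: "finite I"
    using supp finite_subset by blast
  \<comment> \<open>The variables of I, then those of its complement in {1..N}, each block by
    decreasing exponent; sending position i to the i-th variable in this list yields the sorting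
    permutation \<open>v\<close>.\<close>
  define xs where "xs = rev (sort_key (lookup e) (sorted_list_of_set I))"
  define ys where "ys = rev (sort_key (lookup e) (sorted_list_of_set ({1..N} - I)))"
  define zs where "zs = xs @ ys"
  have xs: "set xs = I" "distinct xs" "sorted_wrt (\<ge>) (map (lookup e) xs)"
    using fin by (simp_all add: xs_def rev_map[symmetric] sorted_wrt_rev del: rev_map)
  have ys: "set ys = {1..N} - I" "distinct ys" "sorted_wrt (\<ge>) (map (lookup e) ys)"
    by (simp_all add: ys_def rev_map[symmetric] sorted_wrt_rev)
  have zs: "set zs = {1..N}" "distinct zs"
    using xs ys supp by (auto simp: zs_def)
  then have len: "length zs = N"
    by (metis card_atLeastAtMost diff_Suc_1 distinct_card)
  define v where "v i = (if i \<in> {1..N} then zs ! (i - 1) else i)" for i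
  have v: "v permutes {1..N}"
  proof (rule bij_imp_permutes)
    have "bij_betw (\<lambda>i. i - 1) {1..N} {..<N}"
      by (rule bij_betw_byWitness[where f' = Suc]) auto
    moreover have "bij_betw ((!) zs) {..<N} {1..N}"
      using bij_betw_nth[OF zs(2)] len zs(1) by simp
    ultimately have "bij_betw ((!) zs \<circ> (\<lambda>i. i - 1)) {1..N} {1..N}"
      by (rule bij_betw_trans)
    then show "bij_betw v {1..N} {1..N}"
      by (rule bij_betw_cong[THEN iffD1, rotated]) (simp add: v_def)
  qed (auto simp: v_def)
  then have bij: "bij v"
    by (rule permutes_bij)
  let ?m = "length xs" and ?e = "Poly_Mapping.map_key v e"
  have m: "?m \<le> N"
    using len by (simp add: zs_def)
  have image: "v ` {1..?m} = I"
  proof -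
    have "v ` {1..?m} = (\<lambda>i. xs ! (i - 1)) ` {1..?m}"
      using m by (intro image_cong) (auto simp: v_def zs_def nth_append)
    also have "\<dots> = (!) xs ` {..<?m}"
      by (force simp: image_iff intro: bexI[of _ "Suc _"])
    finally show ?thesis
      using xs(1) by (simp add: set_conv_nth image_def) blast
  qed
  have e': "lookup ?e i = (if i \<in> {1..N} then map (lookup e) zs ! (i - 1) else 0)" for i
    using bij supp len by (auto simp: lookup_map_key bij_is_inj v_def in_keys_iff)
  have nz: "lookup (lookup f {1..?m}) ?e \<noteq> 0"
    using lookup_symmetric[OF f v, of "{1..?m}"] e bij unfolding image
    by (auto simp: lookup_Const_mult lookup_perm_x)
  have "map (lookup e) xs ! k > map (lookup e) xs ! Suc k" if k: "Suc k < ?m" for k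
  proof (rule ccontr)
    \<comment> \<open>Positions in the list start at 0 and variables at 1, so entries
      \<open>k\<close> and \<open>Suc k\<close> belong to these two variables.\<close>
    let ?t = "Transposition.transpose (Suc k) (Suc (Suc k))"
    assume "\<not> map (lookup e) xs ! k > map (lookup e) xs ! Suc k"
    then have "map (lookup e) xs ! k = map (lookup e) xs ! Suc k"
      using sorted_wrt_nth_less[OF xs(3), of k "Suc k"] k by simp
    then have "lookup ?e (Suc k) = lookup ?e (Suc (Suc k))"
      unfolding e' using k m len by (simp add: zs_def nth_append)
    then have "Poly_Mapping.map_key ?t ?e = ?e"
      by (intro poly_mapping_eqI) (auto simp: lookup_map_key Transposition.transpose_def)
    moreover have "?t permutes {1..N}"
      using k m by (intro permutes_swap_id) auto
    moreover have "?t ` {1..?m} = {1..?m}"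
      using k by (intro permutes_image permutes_swap_id) auto
    moreover have "theta_sign ?t {1..?m} = - 1"
      using k by (intro theta_sign_adjacent) auto
    ultimately have "lookup (lookup f {1..?m}) ?e = - lookup (lookup f {1..?m}) ?e"
      using lookup_symmetric[OF f, of ?t "{1..?m}"] by (metis bij_transpose lookup_Const_mult lookup_perm_x mult_minus1)
    then show False
      using nz by simp
  qed
  then have strict: "sorted_wrt (>) (map (lookup e) xs)"
    by (subst sorted_wrt_iff_nth_Suc_transp) (auto simp: transp_def)
  let ?\<Lambda> = "(map (lookup e) xs, map (lookup e) ys)"
  have \<Lambda>: "?\<Lambda> \<in> superpartitions N"
    using strict ys len by (simp add: superpartitions_def zs_def)
  have "sp_exponent ?\<Lambda> = ?e"
    by (rule poly_mapping_eqI)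
      (use len in \<open>simp add: lookup_sp_exponent e' sp_entries_def zs_def\<close>)
  then have "leading ?\<Lambda> f \<noteq> 0"
    using nz by (simp add: leading_def fermion_number_def)
  then show False
    using lead[OF \<Lambda>] by simp
qed

text \<open>The combination \<open>g\<close> is chosen to have the leading coefficients of
  \<open>f\<close>, so \<open>symmetric_eq_0\<close> applies to the difference. The explicit set
  \<open>S\<close> lets the lemma serve arbitrary symmetric elements as well as homogeneous
  ones.\<close>

lemma symmetric_in_span_monomial_super:
  assumes f: "f \<in> symmetric_superpolys N" and S: "finite S" "S \<subseteq> superpartitions N"
    and lead: "\<And>\<Lambda>. \<Lambda> \<in> superpartitions N \<Longrightarrow> leading \<Lambda> f \<noteq> 0 \<Longrightarrow> \<Lambda> \<in> S"
  shows "f \<in> superpoly.span (monomial_super N ` S)"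
proof -
  define g where "g = (\<Sum>\<Lambda>\<in>S. super_scale (leading \<Lambda> f / leading \<Lambda> (monomial_super N \<Lambda>)) (monomial_super N \<Lambda>))"
  have "f - g \<in> symmetric_superpolys N"
    unfolding g_def using f S
    by (intro superpoly.subspace_diff superpoly.subspace_sum superpoly.subspace_scale
        subspace_symmetric_superpolys monomial_super_symmetric) auto
  moreover have "leading \<Omega> (f - g) = 0" if \<Omega>: "\<Omega> \<in> superpartitions N" for \<Omega>
  proof -
    have "leading \<Omega> g = (\<Sum>\<Lambda>\<in>S. if \<Lambda> = \<Omega> then leading \<Omega> f else 0)"
      unfolding g_def leading_sum leading_scale
      using S \<Omega> leading_monomial_super_other[of _ N \<Omega>] leading_monomial_super_nonzero[OF \<Omega>]
      by (intro sum.cong) auto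
    then show ?thesis
      using S lead[OF \<Omega>] by (auto simp: leading_diff)
  qed
  ultimately have "f - g = 0"
    by (rule symmetric_eq_0)
  then have "f = g"
    by simp
  also have "g \<in> superpoly.span (monomial_super N ` S)"
    unfolding g_def by (intro superpoly.span_sum superpoly.span_scale superpoly.span_base) auto
  finally show ?thesis .
qed

lemma span_monomial_super:
  "superpoly.span (monomial_super N ` superpartitions N) = symmetric_superpolys N"
proof
  show "superpoly.span (monomial_super N ` superpartitions N) \<subseteq> symmetric_superpolys N"
    by (intro superpoly.span_minimal subspace_symmetric_superpolys) (auto simp: monomial_super_symmetric)
  show "symmetric_superpolys N \<subseteq> superpoly.span (monomial_super N ` superpartitions N)"
  proof
    fix f assume f: "f \<in> symmetric_superpolys N"
    let ?S = "{\<Lambda> \<in> superpartitions N. leading \<Lambda> f \<noteq> 0}"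
    let ?h = "\<lambda>\<Lambda>. ({1..fermion_number \<Lambda>}, sp_exponent \<Lambda>)"
    \<comment> \<open>A superpartition is recovered from its fermionic block and exponents, which is
      \<open>sp_exponent_permuted\<close> for the identity. Finite support of \<open>f\<close> thus
      leaves finitely many nonzero leading coefficients.\<close>
    have "inj_on ?h ?S"
      using sp_exponent_permuted(1)[OF _ _ permutes_id] by (auto simp: inj_on_def)
    moreover have "?h ` ?S \<subseteq> Sigma (keys f) (\<lambda>I. keys (lookup f I))"
      by (auto simp: leading_def in_keys_iff)
    ultimately have "finite ?S"
      by (rule inj_on_finite) simp
    then have "f \<in> superpoly.span (monomial_super N ` ?S)"
      using f by (intro symmetric_in_span_monomial_super) auto
    then show "f \<in> superpoly.span (monomial_super N ` superpartitions N)"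
      using superpoly.span_mono[of "monomial_super N ` ?S" "monomial_super N ` superpartitions N"] by auto
  qed
qed

lemma finite_superpartitions_le: "finite {\<Lambda> \<in> superpartitions N. sp_degree \<Lambda> \<le> d}"
proof (rule finite_subset)
  let ?L = "{xs. set xs \<subseteq> {..d} \<and> length xs \<le> N}"
  show "{\<Lambda> \<in> superpartitions N. sp_degree \<Lambda> \<le> d} \<subseteq> ?L \<times> ?L"
    by (auto simp: superpartitions_def sp_degree_def sp_entries_def dest!: member_le_sum_list)
  show "finite (?L \<times> ?L)"
    by (simp add: finite_lists_length_le)
qed

section \<open>The Jack basis\<close>

lemma partial_sums_le_antisym:
  assumes "partial_sums_le as bs" "partial_sums_le bs as" "length as = length bs"
  shows "as = bs"
proof (rule nth_equalityI[OF assms(3)])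
  fix i assume i: "i < length as"
  have eq: "sum_list (take k as) = sum_list (take k bs)" for k
    using assms by (auto simp: partial_sums_le_def intro: antisym)
  show "as ! i = bs ! i"
    using eq[of i] eq[of "Suc i"] i assms(3) by (simp add: take_Suc_conv_app_nth)
qed

lemma partial_sums_le_trans: "partial_sums_le as bs \<Longrightarrow> partial_sums_le bs cs \<Longrightarrow> partial_sums_le as cs"
  unfolding partial_sums_le_def by (meson order_trans)

lemma sp_dominance_le_antisym:
  assumes "\<Omega> \<in> superpartitions N" "\<Lambda> \<in> superpartitions N" "sp_dominance_le \<Omega> \<Lambda>" "sp_dominance_le \<Lambda> \<Omega>"
  shows "\<Omega> = \<Lambda>"
proof -
  have len: "length (sp_entries \<Omega>) = N" "length (sp_entries \<Lambda>) = N"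
    using assms by (simp_all add: length_sp_entries)
  then have "sp_star \<Omega> = sp_star \<Lambda>"
    using assms(3,4) partial_sums_le_antisym[of "sp_star \<Omega>" "sp_star \<Lambda>"]
    by (auto simp: sp_dominance_le_def sp_star_def)
  then have "sp_entries \<Omega> = sp_entries \<Lambda>"
    using assms(3,4) len by (intro partial_sums_le_antisym) (auto simp: sp_dominance_le_def)
  moreover have "length (fst \<Omega>) = length (fst \<Lambda>)"
    using assms(3) by (simp add: sp_dominance_le_def fermion_number_def)
  ultimately show ?thesis
    by (simp add: sp_entries_def prod_eq_iff)
qed

text \<open>The delicate case has both comparisons strict on the rearranged partitions: if the
  composite returned to the same partition, antisymmetry of the partial sums would make all three
  agree.\<close>

lemma sp_dominance_le_trans:
  assumes S: "\<Omega> \<in> superpartitions N" "\<Lambda> \<in> superpartitions N" "\<Gamma> \<in> superpartitions N"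
    and le: "sp_dominance_le \<Omega> \<Lambda>" "sp_dominance_le \<Lambda> \<Gamma>"
  shows "sp_dominance_le \<Omega> \<Gamma>"
proof -
  have "length (sp_star \<Omega>) = length (sp_star \<Lambda>)"
    using S by (simp add: sp_star_def length_sp_entries)
  then show ?thesis
    using le partial_sums_le_antisym[of "sp_star \<Omega>" "sp_star \<Lambda>"] partial_sums_le_trans
    unfolding sp_dominance_le_def by metis
qed

text \<open>Supplies the natural-valued rank for the triangularity lemmas. The lower sets are finite
  since dominance fixes the degree, and \<open>\<Omega>\<close> itself lies in the larger set but
  not in the smaller.\<close>

lemma card_dominance_less:
  assumes "\<Omega> \<in> superpartitions N" "\<Lambda> \<in> superpartitions N" "sp_dominance_less \<Omega> \<Lambda>"
  shows "card {\<Gamma> \<in> superpartitions N. sp_dominance_less \<Gamma> \<Omega>} < card {\<Gamma> \<in> superpartitions N. sp_dominance_less \<Gamma> \<Lambda>}"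
proof (rule psubset_card_mono)
  show "finite {\<Gamma> \<in> superpartitions N. sp_dominance_less \<Gamma> \<Lambda>}"
    by (rule finite_subset[OF _ finite_superpartitions_le[of N "sp_degree \<Lambda>"]])
      (auto simp: sp_dominance_less_def sp_dominance_le_def)
  show "{\<Gamma> \<in> superpartitions N. sp_dominance_less \<Gamma> \<Omega>} \<subset> {\<Gamma> \<in> superpartitions N. sp_dominance_less \<Gamma> \<Lambda>}"
    using assms sp_dominance_le_antisym[of _ N] sp_dominance_le_trans[of _ N \<Omega> \<Lambda>]
    unfolding sp_dominance_less_def by blast
qed

text \<open>A drop by \<open>2 * n\<close> with \<open>n \<ge> 1\<close> already makes the two
  superpartitions distinct.\<close>

lemma u_less_iff: "u_less \<Omega> \<Lambda> \<longleftrightarrow> (\<exists>n\<ge>1. int (sp_degree \<Omega>) = int (sp_degree \<Lambda>) - 2 * int n)"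
  by (auto simp: u_less_def u_le_def)

lemma u_less_trans:
  assumes "u_less \<Omega> \<Lambda>" "u_less \<Lambda> \<Gamma>"
  shows "u_less \<Omega> \<Gamma>"
proof -
  obtain m n where "m \<ge> 1" "int (sp_degree \<Omega>) = int (sp_degree \<Lambda>) - 2 * int m"
      "n \<ge> 1" "int (sp_degree \<Lambda>) = int (sp_degree \<Gamma>) - 2 * int n"
    using assms unfolding u_less_iff by blast
  then show ?thesis
    unfolding u_less_iff by (intro exI[of _ "m + n"]) auto
qed

lemma finite_u_less: "finite {\<Omega> \<in> superpartitions N. u_less \<Omega> \<Lambda>}"
  by (rule finite_subset[OF _ finite_superpartitions_le[of N "sp_degree \<Lambda>"]]) (auto simp: u_less_iff)

section \<open>The Euler operator\<close>

lemma euler_add: "euler N (A + B) = euler N A + euler N B"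
proof -
  have "partial_deriv j (p + q) = partial_deriv j p + partial_deriv j q" for j p q
    by (rule poly_mapping_eqI) (simp add: lookup_partial_deriv lookup_add distrib_left)
  moreover have "partial_deriv j 0 = 0" for j
    by (simp add: partial_deriv_def)
  ultimately show ?thesis
    by (intro superpoly_eqI) (simp add: euler_def lookup_sum lookup_map_zero lookup_add distrib_left sum.distrib)
qed

lemma lookup_euler:
  "lookup (lookup (euler N A) I) e = of_nat (\<Sum>j\<in>{1..N}. lookup e j) * lookup (lookup A I) e"
proof -
  have "lookup (Var j * partial_deriv j p) e = of_nat (lookup e j) * lookup p e" for j p
  proof (cases "lookup e j = 0")
    case False
    then have "e - single j 1 + single j 1 = e"
      by (intro poly_mapping_eqI) (auto simp: lookup_add lookup_minus lookup_single when_def)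
    then show ?thesis
      using False by (simp add: lookup_Var_mult lookup_partial_deriv lookup_minus)
  qed (simp add: lookup_Var_mult)
  then show ?thesis
    by (simp add: euler_def lookup_sum lookup_map_zero partial_deriv_def[of _ 0] sum_distrib_right)
qed

lemma euler_scale: "euler N (super_scale c A) = super_scale c (euler N A)"
  by (intro superpoly_eqI poly_mapping_eqI) (simp add: lookup_euler lookup_super_scale lookup_Const_mult)

text \<open>The Euler operator sees only the exponents of the first N variables; for elements of
  \<open>superpolynomials N\<close> their sum is the full degree.\<close>

lemma euler_homogeneous:
  assumes "A \<in> superpolynomials N" "super_homogeneous (\<lambda>_. 1) (int d) A"
  shows "euler N A = super_scale (of_nat d) A"
proof (intro superpoly_eqI poly_mapping_eqI)
  fix I e
  show "lookup (lookup (euler N A) I) e = lookup (lookup (super_scale (of_nat d) A) I) e"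
  proof (cases "lookup (lookup A I) e = 0")
    case False
    then have "keys e \<subseteq> {1..N}"
      using assms(1) unfolding superpolynomials_iff super_homogeneous_def homogeneous_def weight_outside by blast
    then have "weight (\<lambda>_. 1) e = int (\<Sum>j\<in>{1..N}. lookup e j)"
      by (simp add: weight_superset[of "{1..N}"])
    moreover have "weight (\<lambda>_. 1) e = int d"
      using assms(2) False unfolding super_homogeneous_def homogeneous_def by blast
    ultimately have "(\<Sum>j\<in>{1..N}. lookup e j) = d"
      by (metis of_nat_eq_iff)
    then show ?thesis
      by (simp add: lookup_euler lookup_super_scale lookup_Const_mult)
  qed (simp add: lookup_euler lookup_super_scale lookup_Const_mult)
qed

section \<open>Span and independence of the Jack family\<close>

context
  fixes N \<beta> :: nat and J :: "superpartition \<Rightarrow> superpoly"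
  assumes jack: "jack_family N \<beta> J"
begin

lemma jack_expansion:
  obtains t where "\<And>\<Lambda>. \<Lambda> \<in> superpartitions N \<Longrightarrow> J \<Lambda> = monomial_super N \<Lambda> +
    (\<Sum>\<Omega> \<in> {\<Omega> \<in> superpartitions N. sp_dominance_less \<Omega> \<Lambda>}. super_scale (t \<Lambda> \<Omega>) (monomial_super N \<Omega>))"
proof -
  have "\<forall>\<Lambda>\<in>superpartitions N. \<exists>t. J \<Lambda> = monomial_super N \<Lambda> +
    (\<Sum>\<Omega> \<in> {\<Omega> \<in> superpartitions N. sp_dominance_less \<Omega> \<Lambda>}. super_scale (t \<Omega>) (monomial_super N \<Omega>))"
    using jack by (simp add: jack_family_def)
  from bchoice[OF this] obtain t where "\<forall>\<Lambda>\<in>superpartitions N. J \<Lambda> = monomial_super N \<Lambda> +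
    (\<Sum>\<Omega> \<in> {\<Omega> \<in> superpartitions N. sp_dominance_less \<Omega> \<Lambda>}. super_scale (t \<Lambda> \<Omega>) (monomial_super N \<Omega>))" ..
  then show ?thesis
    using that by blast
qed

lemma jack_independent:
  "inj_on J (superpartitions N) \<and> superpoly.independent (J ` superpartitions N)"
proof -
  obtain t where t: "\<And>\<Lambda>. \<Lambda> \<in> superpartitions N \<Longrightarrow> J \<Lambda> = monomial_super N \<Lambda> +
    (\<Sum>\<Omega> \<in> {\<Omega> \<in> superpartitions N. sp_dominance_less \<Omega> \<Lambda>}. super_scale (t \<Lambda> \<Omega>) (monomial_super N \<Omega>))"
    using jack_expansion by blast
  show ?thesis
  proof (rule superpoly.independent_unitriangular[OF _ _ _ t monomial_super_independent])
    fix \<Lambda> :: superpartition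
    show "finite {\<Omega> \<in> superpartitions N. sp_dominance_less \<Omega> \<Lambda>}"
      by (rule finite_subset[OF _ finite_superpartitions_le[of N "sp_degree \<Lambda>"]])
        (auto simp: sp_dominance_less_def sp_dominance_le_def)
  qed (use card_dominance_less in auto)
qed

text \<open>Stated for any set closed downwards in dominance, in order to cover all superpartitions
  as well as those of one degree.\<close>

lemma span_jack:
  assumes S: "S \<subseteq> superpartitions N"
    and closed: "\<And>\<Lambda> \<Omega>. \<Lambda> \<in> S \<Longrightarrow> \<Omega> \<in> superpartitions N \<Longrightarrow> sp_dominance_less \<Omega> \<Lambda> \<Longrightarrow> \<Omega> \<in> S"
  shows "superpoly.span (J ` S) = superpoly.span (monomial_super N ` S)"
proof -
  obtain t where t: "\<And>\<Lambda>. \<Lambda> \<in> superpartitions N \<Longrightarrow> J \<Lambda> = monomial_super N \<Lambda> +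
    (\<Sum>\<Omega> \<in> {\<Omega> \<in> superpartitions N. sp_dominance_less \<Omega> \<Lambda>}. super_scale (t \<Lambda> \<Omega>) (monomial_super N \<Omega>))"
    using jack_expansion by blast
  show ?thesis
  proof (rule superpoly.span_unitriangular)
    show "J \<Lambda> = monomial_super N \<Lambda> +
        (\<Sum>\<Omega> \<in> {\<Omega> \<in> superpartitions N. sp_dominance_less \<Omega> \<Lambda>}. super_scale (t \<Lambda> \<Omega>) (monomial_super N \<Omega>))"
      if "\<Lambda> \<in> S" for \<Lambda>
      using that S by (intro t) auto
    show "{\<Omega> \<in> superpartitions N. sp_dominance_less \<Omega> \<Lambda>} \<subseteq> S" if "\<Lambda> \<in> S" for \<Lambda>
      using that closed by blast
    show "card {\<Gamma> \<in> superpartitions N. sp_dominance_less \<Gamma> \<Omega>} < card {\<Gamma> \<in> superpartitions N. sp_dominance_less \<Gamma> \<Lambda>}"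
      if "\<Lambda> \<in> S" "\<Omega> \<in> {\<Omega> \<in> superpartitions N. sp_dominance_less \<Omega> \<Lambda>}" for \<Lambda> \<Omega>
      using that S by (intro card_dominance_less) auto
  qed
qed

lemma jack_symmetric: "\<Lambda> \<in> superpartitions N \<Longrightarrow> J \<Lambda> \<in> symmetric_superpolys N"
  using jack by (simp add: jack_family_def)

lemma span_jack_symmetric: "superpoly.span (J ` superpartitions N) = symmetric_superpolys N"
  using span_jack[of "superpartitions N"] by (simp add: span_monomial_super)

lemma super_homogeneous_jack:
  assumes "\<Lambda> \<in> superpartitions N"
  shows "super_homogeneous (\<lambda>_. 1) (int (sp_degree \<Lambda>)) (J \<Lambda>)"
proof -
  obtain t where t: "\<And>\<Lambda>. \<Lambda> \<in> superpartitions N \<Longrightarrow> J \<Lambda> = monomial_super N \<Lambda> +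
    (\<Sum>\<Omega> \<in> {\<Omega> \<in> superpartitions N. sp_dominance_less \<Omega> \<Lambda>}. super_scale (t \<Lambda> \<Omega>) (monomial_super N \<Omega>))"
    using jack_expansion by blast
  have "super_homogeneous (\<lambda>_. 1) (int (sp_degree \<Lambda>)) (monomial_super N \<Omega>)"
    if "\<Omega> \<in> superpartitions N" "sp_dominance_less \<Omega> \<Lambda>" for \<Omega>
    using super_homogeneous_monomial_super[OF that(1)] that(2)
    by (simp add: sp_dominance_less_def sp_dominance_le_def)
  then show ?thesis
    unfolding t[OF assms] using assms
    by (intro super_homogeneous_add super_homogeneous_sum super_homogeneous_scale super_homogeneous_monomial_super) auto
qed

lemma euler_jack: "\<Lambda> \<in> superpartitions N \<Longrightarrow> euler N (J \<Lambda>) = super_scale (of_nat (sp_degree \<Lambda>)) (J \<Lambda>)"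
  using jack_symmetric super_homogeneous_jack
  by (intro euler_homogeneous) (auto simp: symmetric_superpolys_iff)

text \<open>Homogeneity kills the leading coefficients at other degrees, and the superpartitions of
  one degree are closed under dominance. The degree is an integer because powers of Delta may push
  it below zero, where the index set is empty.\<close>

lemma symmetric_homogeneous_in_span_jack:
  assumes "f \<in> symmetric_superpolys N" "super_homogeneous (\<lambda>_. 1) d f"
  shows "f \<in> superpoly.span (J ` {\<Lambda> \<in> superpartitions N. int (sp_degree \<Lambda>) = d})" (is "_ \<in> superpoly.span (J ` ?S)")
proof -
  have "f \<in> superpoly.span (monomial_super N ` ?S)"
  proof (rule symmetric_in_span_monomial_super[OF assms(1)])
    show "finite ?S"
      by (rule finite_subset[OF _ finite_superpartitions_le[of N "nat d"]]) auto
    show "\<Lambda> \<in> ?S" if "\<Lambda> \<in> superpartitions N" "leading \<Lambda> f \<noteq> 0" for \<Lambda>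
      using that assms(2) weight_sp_exponent[of \<Lambda>]
      unfolding leading_def super_homogeneous_def homogeneous_def by force
  qed auto
  moreover have "superpoly.span (J ` ?S) = superpoly.span (monomial_super N ` ?S)"
    by (rule span_jack) (auto simp: sp_dominance_less_def sp_dominance_le_def)
  ultimately show ?thesis
    by simp
qed

lemma in_span_jackE:
  assumes "f \<in> superpoly.span (J ` S)" "S \<subseteq> superpartitions N" "finite S"
  obtains w where "f = (\<Sum>\<Omega>\<in>S. super_scale (w \<Omega>) (J \<Omega>))"
proof -
  obtain u where "f = (\<Sum>v\<in>J ` S. super_scale (u v) v)"
    using assms by (auto simp: superpoly.span_finite)
  moreover have "inj_on J S"
    using jack_independent assms(2) inj_on_subset by blast
  ultimately have "f = (\<Sum>\<Omega>\<in>S. super_scale (u (J \<Omega>)) (J \<Omega>))"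
    by (simp add: sum.reindex)
  then show ?thesis
    by (rule that)
qed

end

section \<open>The exponential of a locally nilpotent operator\<close>

text \<open>\<open>Sum_any\<close> returns 0 when infinitely many terms are nonzero, so the laws of
  \<open>exp_op\<close> are proved for vectors on which the series terminates.\<close>

definition nilpotent_at :: "(superpoly \<Rightarrow> superpoly) \<Rightarrow> superpoly \<Rightarrow> bool" where
  "nilpotent_at L A \<longleftrightarrow> (\<exists>n. (L ^^ n) A = 0)"

context
  fixes L :: "superpoly \<Rightarrow> superpoly"
  assumes L_add: "L (A + B) = L A + L B" and L_scale: "L (super_scale c A) = super_scale c (L A)"
begin

lemma L_zero [simp]: "L 0 = 0"
  using L_add[of 0 0] by simp

lemma pow_zero [simp]: "(L ^^ n) 0 = 0"
  by (induction n) simp_all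

lemma pow_add: "(L ^^ n) (A + B) = (L ^^ n) A + (L ^^ n) B"
  by (induction n) (simp_all add: L_add)

lemma pow_scale: "(L ^^ n) (super_scale c A) = super_scale c ((L ^^ n) A)"
  by (induction n) (simp_all add: L_scale)

lemma pow_sum: "(L ^^ n) (sum f S) = (\<Sum>a\<in>S. (L ^^ n) (f a))"
  by (induction S rule: infinite_finite_induct) (simp_all add: pow_add)

lemma pow_eq_0_mono:
  assumes "(L ^^ n) A = 0" "n \<le> m"
  shows "(L ^^ m) A = 0"
proof -
  have "(L ^^ m) A = (L ^^ (m - n)) ((L ^^ n) A)"
    using assms(2) by (metis comp_apply funpow_add le_add_diff_inverse2)
  then show ?thesis
    using assms(1) by simp
qed

lemma nilpotent_at_add:
  assumes "nilpotent_at L A" "nilpotent_at L B"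
  shows "nilpotent_at L (A + B)"
proof -
  obtain m n where "(L ^^ m) A = 0" "(L ^^ n) B = 0"
    using assms by (auto simp: nilpotent_at_def)
  then have "(L ^^ max m n) (A + B) = 0"
    using pow_eq_0_mono[of m A "max m n"] pow_eq_0_mono[of n B "max m n"] by (simp add: pow_add)
  then show ?thesis
    by (auto simp: nilpotent_at_def)
qed

lemma nilpotent_at_scale: "nilpotent_at L A \<Longrightarrow> nilpotent_at L (super_scale c A)"
  unfolding nilpotent_at_def pow_scale by force

text \<open>Any annihilating exponent may serve as the cut-off, so several vectors can share
  one.\<close>

lemma exp_op_eq:
  assumes "(L ^^ n) A = 0"
  shows "exp_op c L A = (\<Sum>k<n. super_scale (c ^ k / fact k) ((L ^^ k) A))"
  unfolding exp_op_def
proof (rule Sum_any.expand_superset)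
  show "{k. super_scale (c ^ k / fact k) ((L ^^ k) A) \<noteq> 0} \<subseteq> {..<n}"
    using pow_eq_0_mono[OF assms] by (force simp: not_less[symmetric])
qed simp

lemma exp_op_add:
  assumes "nilpotent_at L A" "nilpotent_at L B"
  shows "exp_op c L (A + B) = exp_op c L A + exp_op c L B"
proof -
  obtain m n where mn: "(L ^^ m) A = 0" "(L ^^ n) B = 0"
    using assms by (auto simp: nilpotent_at_def)
  then have "(L ^^ max m n) A = 0" "(L ^^ max m n) B = 0"
    using pow_eq_0_mono[of m A "max m n"] pow_eq_0_mono[of n B "max m n"] by auto
  moreover from this have "(L ^^ max m n) (A + B) = 0"
    by (simp add: pow_add)
  ultimately show ?thesis
    by (simp add: exp_op_eq[of "max m n"] pow_add superpoly.scale_right_distrib sum.distrib)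
qed

lemma exp_op_scale:
  assumes "nilpotent_at L A"
  shows "exp_op c L (super_scale a A) = super_scale a (exp_op c L A)"
proof -
  obtain n where n: "(L ^^ n) A = 0"
    using assms by (auto simp: nilpotent_at_def)
  then have "(L ^^ n) (super_scale a A) = 0"
    by (simp add: pow_scale)
  then show ?thesis
    using n by (simp add: exp_op_eq[of n] pow_scale superpoly.scale_sum_right mult.commute)
qed

lemma exp_op_sum:
  assumes "\<And>i. i \<in> S \<Longrightarrow> nilpotent_at L (f i)"
  shows "exp_op c L (sum f S) = (\<Sum>i\<in>S. exp_op c L (f i)) \<and> nilpotent_at L (sum f S)"
  using assms
proof (induction S rule: infinite_finite_induct)
  case (insert x F)
  then show ?case
    by (simp add: exp_op_add nilpotent_at_add)
qed (simp_all add: exp_op_eq[of 0] nilpotent_at_def)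

text \<open>The Cauchy product: terms beyond the cut-off vanish, and grouping the rest by
  \<open>s = k + m\<close> gives the exponential coefficients of \<open>c + - c = 0\<close>, nonzero
  only for \<open>s = 0\<close>.\<close>

lemma exp_op_minus:
  assumes "nilpotent_at L A"
  shows "exp_op c L (exp_op (- c) L A) = A"
proof -
  obtain n where "(L ^^ n) A = 0"
    using assms by (auto simp: nilpotent_at_def)
  \<comment> \<open>A successor as cut-off makes the final sum nonempty, so that its term at 0 can
    be split off.\<close>
  then have n: "(L ^^ Suc n) A = 0"
    by simp
  let ?N = "Suc n"
  let ?a = "\<lambda>c k. c ^ k / fact k :: complex"
  have pow_exp: "(L ^^ k) (exp_op (- c) L A) = (\<Sum>m<?N. super_scale (?a (- c) m) ((L ^^ (k + m)) A))" for k
    unfolding exp_op_eq[OF n] pow_sum pow_scale by (simp add: funpow_add)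
  have "(L ^^ ?N) (exp_op (- c) L A) = 0"
    unfolding pow_exp by (intro sum.neutral ballI) (metis le_add1 n pow_eq_0_mono superpoly.scale_zero_right)
  then have "exp_op c L (exp_op (- c) L A) =
      (\<Sum>k<?N. super_scale (?a c k) (\<Sum>m<?N. super_scale (?a (- c) m) ((L ^^ (k + m)) A)))"
    by (simp only: exp_op_eq pow_exp)
  also have "\<dots> = (\<Sum>(k, m)\<in>{..<?N} \<times> {..<?N}. super_scale (?a c k * ?a (- c) m) ((L ^^ (k + m)) A))"
    by (simp only: superpoly.scale_sum_right superpoly.scale_scale sum.cartesian_product)
  also have "\<dots> = (\<Sum>(k, m)\<in>{(k, m). k + m < ?N}. super_scale (?a c k * ?a (- c) m) ((L ^^ (k + m)) A))"
  proof (rule sum.mono_neutral_right)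
    show "\<forall>x\<in>{..<?N} \<times> {..<?N} - {(k, m). k + m < ?N}.
        (case x of (k, m) \<Rightarrow> super_scale (?a c k * ?a (- c) m) ((L ^^ (k + m)) A)) = 0"
    proof
      fix x assume "x \<in> {..<?N} \<times> {..<?N} - {(k, m). k + m < ?N}"
      then obtain k m where x: "x = (k, m)" "?N \<le> k + m"
        by (cases x) auto
      then have "(L ^^ (k + m)) A = 0"
        by (intro pow_eq_0_mono[OF n])
      then show "(case x of (k, m) \<Rightarrow> super_scale (?a c k * ?a (- c) m) ((L ^^ (k + m)) A)) = 0"
        by (simp add: x)
    qed
  qed auto
  also have "\<dots> = (\<Sum>s<?N. \<Sum>k\<le>s. super_scale (?a c k * ?a (- c) (s - k)) ((L ^^ s) A))"
    by (subst sum.triangle_reindex) simp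
  also have "\<dots> = (\<Sum>s<?N. super_scale (?a (c + - c) s) ((L ^^ s) A))"
  proof (rule sum.cong[OF refl])
    fix s
    \<comment> \<open>The binomial theorem divided by \<open>fact s\<close>, taken from the addition
      law of the exponential series.\<close>
    have "?a (c + - c) s = (\<Sum>k\<le>s. ?a c k * ?a (- c) (s - k))"
      using exp_series_add_commuting[of c "- c" s] by (simp add: scaleR_conv_of_real field_simps)
    then show "(\<Sum>k\<le>s. super_scale (?a c k * ?a (- c) (s - k)) ((L ^^ s) A)) =
        super_scale (?a (c + - c) s) ((L ^^ s) A)"
      by (simp add: superpoly.scale_sum_left)
  qed
  also have "\<dots> = A"
    by (subst sum.lessThan_Suc_shift) simp
  finally show ?thesis .
qed

end

section \<open>Generalized Hermite superpolynomials\<close>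

lemma super_homogeneous_laplacian_pow:
  assumes "super_homogeneous (\<lambda>_. 1) d A"
  shows "super_homogeneous (\<lambda>_. 1) (d - 2 * int n) ((laplacian N b ^^ n) A)"
proof (induction n)
  case (Suc n)
  show ?case
    using super_homogeneous_laplacian[of N "\<lambda>_. 1" 1, OF _ Suc] by (simp add: algebra_simps)
qed (use assms in simp)

lemma nilpotent_laplacian_homogeneous:
  assumes "super_homogeneous (\<lambda>_. 1) d A"
  shows "nilpotent_at (laplacian N b) A"
proof -
  \<comment> \<open>For \<open>d \<ge> 0\<close> this many applications reach degree
    \<open>- d - 2\<close>, below every weight. For negative \<open>d\<close> the truncation gives
    0, and \<open>A\<close> itself vanishes.\<close>
  define n where "n = nat (d + 1)"
  have "super_homogeneous (\<lambda>_. 1) (d - 2 * int n) ((laplacian N b ^^ n) A)"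
    by (rule super_homogeneous_laplacian_pow[OF assms])
  moreover have "d - 2 * int n < weight (\<lambda>_. 1) e" for e
    by (rule less_le_trans[of _ 0]) (auto simp: n_def weight_def intro: sum_nonneg)
  ultimately have "lookup (lookup ((laplacian N b ^^ n) A) I) e = 0" for I e
    unfolding super_homogeneous_def homogeneous_def by (metis less_irrefl)
  then have "(laplacian N b ^^ n) A = 0"
    by (intro superpoly_eqI poly_mapping_eqI) simp
  then show ?thesis
    unfolding nilpotent_at_def by blast
qed

lemma laplacian_pow_symmetric:
  "A \<in> symmetric_superpolys N \<Longrightarrow> (laplacian N b ^^ n) A \<in> symmetric_superpolys N"
  by (induction n) (simp_all add: laplacian_symmetric)

lemma euler_zero [simp]: "euler N 0 = 0"
  using euler_add[of N 0 0] by simp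

context
  fixes N \<beta> :: nat and J :: "superpartition \<Rightarrow> superpoly" and b :: complex
  assumes jack: "jack_family N \<beta> J"
begin

text \<open>The vectors killed by some power form a subspace, and it contains the homogeneous
  J_Omega. The killing power is not uniform.\<close>

lemma nilpotent_at_symmetric:
  assumes "f \<in> symmetric_superpolys N"
  shows "nilpotent_at (laplacian N b) f"
proof -
  have "f \<in> superpoly.span (J ` superpartitions N)"
    using assms span_jack_symmetric[OF jack] by simp
  then show ?thesis
  proof (induction rule: superpoly.span_induct)
    case base
    have "nilpotent_at (laplacian N b) 0"
      by (auto simp: nilpotent_at_def intro: exI[of _ 0])
    then show ?case
      by (auto simp: superpoly.subspace_def nilpotent_at_add[OF laplacian_add laplacian_scale]
          nilpotent_at_scale[OF laplacian_add laplacian_scale])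
  next
    case (step x)
    then show ?case
      using super_homogeneous_jack[OF jack] by (auto intro: nilpotent_laplacian_homogeneous)
  qed
qed

lemma exp_op_symmetric:
  assumes "f \<in> symmetric_superpolys N"
  shows "exp_op c (laplacian N b) f \<in> symmetric_superpolys N"
proof -
  obtain n where "(laplacian N b ^^ n) f = 0"
    using nilpotent_at_symmetric[OF assms] by (auto simp: nilpotent_at_def)
  then show ?thesis
    by (simp add: exp_op_eq[OF laplacian_add laplacian_scale] superpoly.subspace_sum superpoly.subspace_scale
        subspace_symmetric_superpolys laplacian_pow_symmetric assms)
qed

lemma exp_op_jack:
  assumes \<Lambda>: "\<Lambda> \<in> superpartitions N"
  shows "exp_op c (laplacian N b) (J \<Lambda>) - J \<Lambda> \<in> superpoly.span (J ` {\<Omega> \<in> superpartitions N. u_less \<Omega> \<Lambda>})"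
proof -
  let ?L = "laplacian N b"
  have sym: "J \<Lambda> \<in> symmetric_superpolys N"
    using jack_symmetric[OF jack \<Lambda>] .
  obtain n where "(?L ^^ n) (J \<Lambda>) = 0"
    using nilpotent_at_symmetric[OF sym] by (auto simp: nilpotent_at_def)
  \<comment> \<open>With a successor as cut-off the zeroth term, J_Lambda itself, can be subtracted
    from the sum.\<close>
  then have "(?L ^^ Suc n) (J \<Lambda>) = 0"
    by (rule pow_eq_0_mono[OF laplacian_add laplacian_scale]) simp
  then have "exp_op c ?L (J \<Lambda>) - J \<Lambda> =
      (\<Sum>k<n. super_scale (c ^ Suc k / fact (Suc k)) ((?L ^^ Suc k) (J \<Lambda>)))"
    by (simp only: exp_op_eq[OF laplacian_add laplacian_scale] sum.lessThan_Suc_shift) simp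
  also have "\<dots> \<in> superpoly.span (J ` {\<Omega> \<in> superpartitions N. u_less \<Omega> \<Lambda>})"
  proof (intro superpoly.span_sum superpoly.span_scale)
    fix k
    have "(?L ^^ Suc k) (J \<Lambda>) \<in> superpoly.span (J ` {\<Omega> \<in> superpartitions N.
        int (sp_degree \<Omega>) = int (sp_degree \<Lambda>) - 2 * int (Suc k)})"
      by (intro symmetric_homogeneous_in_span_jack[OF jack] laplacian_pow_symmetric sym
          super_homogeneous_laplacian_pow super_homogeneous_jack[OF jack \<Lambda>])
    moreover have "{\<Omega> \<in> superpartitions N. int (sp_degree \<Omega>) = int (sp_degree \<Lambda>) - 2 * int (Suc k)} \<subseteq>
        {\<Omega> \<in> superpartitions N. u_less \<Omega> \<Lambda>}"
      unfolding u_less_iff by (auto intro!: exI[of _ "Suc k"])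
    ultimately show "(?L ^^ Suc k) (J \<Lambda>) \<in> superpoly.span (J ` {\<Omega> \<in> superpartitions N. u_less \<Omega> \<Lambda>})"
      using superpoly.span_mono[OF image_mono] by blast
  qed
  finally show ?thesis .
qed

lemma u_unitriangular_basis:
  assumes w: "\<And>\<Lambda>. \<Lambda> \<in> superpartitions N \<Longrightarrow>
    G \<Lambda> = J \<Lambda> + (\<Sum>\<Omega> \<in> {\<Omega> \<in> superpartitions N. u_less \<Omega> \<Lambda>}. super_scale (w \<Lambda> \<Omega>) (J \<Omega>))"
  shows "indexed_basis (superpartitions N) G (symmetric_superpolys N)"
proof -
  have less: "sp_degree \<Omega> < sp_degree \<Lambda>" if "u_less \<Omega> \<Lambda>" for \<Omega> \<Lambda>
    using that by (auto simp: u_less_iff)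
  have "inj_on G (superpartitions N) \<and> superpoly.independent (G ` superpartitions N)"
    by (rule superpoly.independent_unitriangular[where \<mu> = sp_degree, OF _ finite_u_less _ w jack_independent[OF jack]])
      (auto simp: less)
  moreover have "superpoly.span (G ` superpartitions N) = superpoly.span (J ` superpartitions N)"
    by (rule superpoly.span_unitriangular[where \<mu> = sp_degree, OF _ _ w]) (auto simp: less)
  ultimately show ?thesis
    by (simp add: indexed_basis_def span_jack_symmetric[OF jack])
qed

text \<open>The Euler operator is diagonal in the Jack family, so the eigenvalue equation says that
  each coefficient times the difference of the degrees is zero, and these differences are nonzero on
  \<open>U\<close>.\<close>

lemma euler_eigenvector_eq_0:
  assumes R: "R \<in> superpoly.span (J ` U)" and U: "U \<subseteq> superpartitions N" "finite U"
    and deg: "\<And>\<Omega>. \<Omega> \<in> U \<Longrightarrow> sp_degree \<Omega> \<noteq> d"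
    and eig: "euler N R = super_scale (of_nat d) R"
  shows "R = 0"
proof -
  obtain r where r: "R = (\<Sum>\<Omega>\<in>U. super_scale (r \<Omega>) (J \<Omega>))"
    using in_span_jackE[OF jack R U] by blast
  have euler_sum: "euler N (sum f A) = (\<Sum>a\<in>A. euler N (f a))" for f :: "superpartition \<Rightarrow> superpoly" and A
  proof (induction A rule: infinite_finite_induct)
    case (insert x F)
    then show ?case by (simp add: euler_add)
  qed simp_all
  have "euler N R = (\<Sum>\<Omega>\<in>U. super_scale (r \<Omega> * of_nat (sp_degree \<Omega>)) (J \<Omega>))"
    unfolding r euler_sum euler_scale
    using U by (intro sum.cong) (auto simp: euler_jack[OF jack])
  moreover have "super_scale (of_nat d) R = (\<Sum>\<Omega>\<in>U. super_scale (r \<Omega> * of_nat d) (J \<Omega>))"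
    unfolding r by (simp add: superpoly.scale_sum_right mult.commute)
  ultimately have "(\<Sum>\<Omega>\<in>U. super_scale (r \<Omega> * (of_nat (sp_degree \<Omega>) - of_nat d)) (J \<Omega>)) = 0"
    using eig by (simp add: right_diff_distrib superpoly.scale_left_diff_distrib sum_subtractf)
  from jack_independent[OF jack, unfolded superpoly.independent_family_iff, rule_format, OF U(2,1) this]
  have "\<forall>\<Omega>\<in>U. r \<Omega> * (of_nat (sp_degree \<Omega>) - of_nat d) = 0"
    by blast
  then have "\<forall>\<Omega>\<in>U. r \<Omega> = 0"
    using deg by simp
  then show ?thesis
    unfolding r by simp
qed

lemma conjugated_euler_eigenvector:
  assumes \<Lambda>: "\<Lambda> \<in> superpartitions N" and w: "G = J \<Lambda> + (\<Sum>\<Omega> \<in> {\<Omega> \<in> superpartitions N. u_less \<Omega> \<Lambda>}. super_scale (w \<Omega>) (J \<Omega>))"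
    and eig: "exp_op (- c) (laplacian N b) (euler N (exp_op c (laplacian N b) G)) = super_scale (of_nat (sp_degree \<Lambda>)) G"
  shows "G = exp_op (- c) (laplacian N b) (J \<Lambda>)"
proof -
  let ?L = "laplacian N b" and ?d = "of_nat (sp_degree \<Lambda>)"
  note L = laplacian_add laplacian_scale
  let ?U = "{\<Omega> \<in> superpartitions N. u_less \<Omega> \<Lambda>}"
  define F where "F = exp_op c ?L G"
  have nil_J: "nilpotent_at ?L (super_scale a (J \<Omega>))" if "\<Omega> \<in> superpartitions N" for a \<Omega>
    using that by (intro nilpotent_at_scale[OF L] nilpotent_at_symmetric jack_symmetric[OF jack])
  have G: "G \<in> symmetric_superpolys N"
    unfolding w using \<Lambda> jack_symmetric[OF jack]
    by (intro superpoly.subspace_add superpoly.subspace_sum superpoly.subspace_scale subspace_symmetric_superpolys) auto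
  have F: "F \<in> symmetric_superpolys N"
    unfolding F_def by (rule exp_op_symmetric[OF G])
  \<comment> \<open>Cancelling the outer exponentials requires nilpotency at
    \<open>euler N F\<close>, which follows once this vector is known to be symmetric.\<close>
  have euler_F: "euler N F \<in> symmetric_superpolys N"
    using F[folded span_jack_symmetric[OF jack]]
  proof (induction rule: superpoly.span_induct)
    case base
    show ?case
      using subspace_symmetric_superpolys[of N]
      by (simp add: superpoly.subspace_def euler_add euler_scale)
  next
    case (step x)
    then show ?case
      using euler_jack[OF jack] jack_symmetric[OF jack]
      by (auto intro!: superpoly.subspace_scale subspace_symmetric_superpolys)
  qed
  have "euler N F = exp_op c ?L (exp_op (- c) ?L (euler N F))"
    using exp_op_minus[OF L nilpotent_at_symmetric[OF euler_F]] by simp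
  also have "\<dots> = super_scale ?d F"
    using eig by (simp add: F_def exp_op_scale[OF L nilpotent_at_symmetric[OF G]])
  finally have euler_F_eq: "euler N F = super_scale ?d F" .
  have "F - J \<Lambda> \<in> superpoly.span (J ` ?U)"
  proof -
    have sum: "exp_op c ?L (\<Sum>\<Omega>\<in>?U. super_scale (w \<Omega>) (J \<Omega>)) = (\<Sum>\<Omega>\<in>?U. exp_op c ?L (super_scale (w \<Omega>) (J \<Omega>)))"
      "nilpotent_at ?L (\<Sum>\<Omega>\<in>?U. super_scale (w \<Omega>) (J \<Omega>))"
      using exp_op_sum[where L = ?L and S = ?U and f = "\<lambda>\<Omega>. super_scale (w \<Omega>) (J \<Omega>)", OF L] nil_J by auto
    have "F = exp_op c ?L (J \<Lambda>) + (\<Sum>\<Omega>\<in>?U. exp_op c ?L (super_scale (w \<Omega>) (J \<Omega>)))"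
      unfolding F_def w sum(1)[symmetric]
      by (rule exp_op_add[OF L _ sum(2)]) (use \<Lambda> nil_J[of \<Lambda> 1] in simp)
    then have "F - J \<Lambda> = (exp_op c ?L (J \<Lambda>) - J \<Lambda>) + (\<Sum>\<Omega>\<in>?U. exp_op c ?L (super_scale (w \<Omega>) (J \<Omega>)))"
      by simp
    also have "\<dots> \<in> superpoly.span (J ` ?U)"
    proof (intro superpoly.span_add superpoly.span_sum exp_op_jack \<Lambda>)
      fix \<Omega> assume \<Omega>: "\<Omega> \<in> ?U"
      \<comment> \<open>Transitivity of the u-order keeps the exponentials of the lower J_Omega
        inside the same span.\<close>
      have "{\<Gamma> \<in> superpartitions N. u_less \<Gamma> \<Omega>} \<subseteq> ?U"
        using \<Omega> u_less_trans by blast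
      then have "exp_op c ?L (J \<Omega>) - J \<Omega> \<in> superpoly.span (J ` ?U)"
        using exp_op_jack[of \<Omega>] \<Omega> superpoly.span_mono[OF image_mono] by blast
      moreover have "J \<Omega> \<in> superpoly.span (J ` ?U)"
        using \<Omega> by (intro superpoly.span_base) auto
      ultimately have "exp_op c ?L (J \<Omega>) \<in> superpoly.span (J ` ?U)"
        using superpoly.span_add by fastforce
      then show "exp_op c ?L (super_scale (w \<Omega>) (J \<Omega>)) \<in> superpoly.span (J ` ?U)"
        using \<Omega> nil_J[of \<Omega> 1] by (simp add: exp_op_scale[OF L] superpoly.span_scale)
    qed
    finally show ?thesis .
  qed
  moreover have "euler N (F - J \<Lambda>) = super_scale ?d (F - J \<Lambda>)"
  proof -
    have "euler N F = euler N (F - J \<Lambda>) + euler N (J \<Lambda>)"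
      by (simp flip: euler_add)
    then show ?thesis
      using euler_F_eq euler_jack[OF jack \<Lambda>] by (simp add: superpoly.scale_right_diff_distrib algebra_simps)
  qed
  ultimately have "F - J \<Lambda> = 0"
    by (intro euler_eigenvector_eq_0[of _ ?U "sp_degree \<Lambda>"] finite_u_less) (auto simp: u_less_iff)
  then have "exp_op (- c) ?L (J \<Lambda>) = exp_op (- c) ?L (exp_op c ?L G)"
    by (simp add: F_def)
  \<comment> \<open>The inversion law is used with \<open>- c\<close>, which puts the two
    exponentials in the opposite order.\<close>
  then show ?thesis
    using exp_op_minus[OF L nilpotent_at_symmetric[OF G], of "- c"] by simp
qed

end

theorem theorem10:
  fixes N \<beta> :: nat and \<omega> :: real and J :: "superpartition \<Rightarrow> superpoly"
  assumes "N \<ge> 1" and "\<beta> \<ge> 1" and "\<omega> > 0"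
    and "jack_family N \<beta> J"
  defines "hermite_basis \<equiv> \<lambda>G :: superpartition \<Rightarrow> superpoly.
      indexed_basis (superpartitions N) G (symmetric_superpolys N) \<and>
      (\<forall>\<Lambda>\<in>superpartitions N.
         rational_H1 N (of_nat \<beta>) (of_real \<omega>) (G \<Lambda>) = super_scale (of_nat (sp_degree \<Lambda>)) (G \<Lambda>)) \<and>
      (\<exists>w. \<forall>\<Lambda>\<in>superpartitions N.
         G \<Lambda> = J \<Lambda> + (\<Sum>\<Omega> | \<Omega> \<in> superpartitions N \<and> u_less \<Omega> \<Lambda>. super_scale (w \<Lambda> \<Omega>) (J \<Omega>)))"
  shows "hermite_basis (gen_hermite N (of_nat \<beta>) (of_real \<omega>) J) \<and>
    (\<forall>G. hermite_basis G \<longrightarrow>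
       (\<forall>\<Lambda>\<in>superpartitions N. G \<Lambda> = gen_hermite N (of_nat \<beta>) (of_real \<omega>) J \<Lambda>))"
proof (intro conjI allI impI ballI)
  let ?L = "laplacian N (of_nat \<beta>)" and ?c = "1 / (4 * of_real \<omega>) :: complex"
  let ?H = "gen_hermite N (of_nat \<beta>) (of_real \<omega>) J"
  note jack = assms(4) and L = laplacian_add laplacian_scale
  have H: "?H \<Lambda> = exp_op (- ?c) ?L (J \<Lambda>)" for \<Lambda>
    by (simp add: gen_hermite_def)
  have nil: "nilpotent_at ?L (J \<Lambda>)" if "\<Lambda> \<in> superpartitions N" for \<Lambda>
    using that by (intro nilpotent_at_symmetric[OF jack] jack_symmetric[OF jack])
  \<comment> \<open>Coefficients are found separately for each superpartition; the claim asks for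
    one function \<open>w\<close>, which choice then provides.\<close>
  have "\<forall>\<Lambda>\<in>superpartitions N. \<exists>w.
      ?H \<Lambda> = J \<Lambda> + (\<Sum>\<Omega> \<in> {\<Omega> \<in> superpartitions N. u_less \<Omega> \<Lambda>}. super_scale (w \<Omega>) (J \<Omega>))"
  proof
    fix \<Lambda> assume \<Lambda>: "\<Lambda> \<in> superpartitions N"
    obtain w where "?H \<Lambda> - J \<Lambda> = (\<Sum>\<Omega> \<in> {\<Omega> \<in> superpartitions N. u_less \<Omega> \<Lambda>}. super_scale (w \<Omega>) (J \<Omega>))"
      using in_span_jackE[OF jack exp_op_jack[OF jack \<Lambda>, of "- ?c" "of_nat \<beta>"] _ finite_u_less] unfolding H by blast
    then show "\<exists>w. ?H \<Lambda> = J \<Lambda> + (\<Sum>\<Omega> \<in> {\<Omega> \<in> superpartitions N. u_less \<Omega> \<Lambda>}. super_scale (w \<Omega>) (J \<Omega>))"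
      by (intro exI[of _ w]) (simp add: algebra_simps)
  qed
  from bchoice[OF this] obtain w where w: "\<forall>\<Lambda>\<in>superpartitions N.
      ?H \<Lambda> = J \<Lambda> + (\<Sum>\<Omega> \<in> {\<Omega> \<in> superpartitions N. u_less \<Omega> \<Lambda>}. super_scale (w \<Lambda> \<Omega>) (J \<Omega>))" ..
  \<comment> \<open>The inner exponential cancels the one defining \<open>?H\<close>, so the Euler
    operator meets J_Lambda itself and the outer exponential restores \<open>?H\<close>.\<close>
  moreover have "rational_H1 N (of_nat \<beta>) (of_real \<omega>) (?H \<Lambda>) = super_scale (of_nat (sp_degree \<Lambda>)) (?H \<Lambda>)"
    if \<Lambda>: "\<Lambda> \<in> superpartitions N" for \<Lambda>
    by (simp only: rational_H1_def H exp_op_minus[OF L nil[OF \<Lambda>]] euler_jack[OF jack \<Lambda>] exp_op_scale[OF L nil[OF \<Lambda>]])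
  ultimately show "hermite_basis ?H"
    unfolding hermite_basis_def using u_unitriangular_basis[OF jack, of ?H w] by blast
next
  fix G \<Lambda>
  assume "hermite_basis G" and \<Lambda>: "\<Lambda> \<in> superpartitions N"
  then obtain w where eig: "rational_H1 N (of_nat \<beta>) (of_real \<omega>) (G \<Lambda>) = super_scale (of_nat (sp_degree \<Lambda>)) (G \<Lambda>)"
    and w: "G \<Lambda> = J \<Lambda> + (\<Sum>\<Omega> \<in> {\<Omega> \<in> superpartitions N. u_less \<Omega> \<Lambda>}. super_scale (w \<Lambda> \<Omega>) (J \<Omega>))"
    unfolding hermite_basis_def by blast
  show "G \<Lambda> = gen_hermite N (of_nat \<beta>) (of_real \<omega>) J \<Lambda>"
    using conjugated_euler_eigenvector[OF assms(4) \<Lambda> w eig[unfolded rational_H1_def]]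
    by (simp add: gen_hermite_def)
qed

end
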